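(* Let $k\ge 1$, $\delta_1,\dots,\delta_k>0$ and $-\infty<b_1<\dots<b_k<\infty$, and, if $X$ has paths of bounded variation, assume $\delta_1+\dots+\delta_k<c$. Then there exists a unique strong solution to the stochastic differential equation $$dU_k(t)=dX(t)-\sum_{i=1}^k\delta_i\mathbf 1_{\{U_k(t)>b_i\}}\,dt .$$
   Context: $X=\{X(t),t\ge0\}$ is a spectrally negative Lévy process (no positive jumps) on a filtered probability space, not having monotone paths, with an arbitrary starting point $X(0)=x\in\mathbb R$. Its Laplace exponent is $\psi(\lambda)=\gamma\lambda+\frac12\sigma^2\lambda^2+\int_0^\infty(e^{-\lambda z}-1+\lambda z\mathbf 1_{(0,1)}(z))\,\Pi(dz)$, $\lambda\ge 0$, where $\gamma\in\mathbb R$, $\sigma\ge0$ and $\int_0^\infty(1\wedge z^2)\,\Pi(dz)<\infty$ (so $\mathbb E_0[e^{\lambda X(t)}]=e^{t\psi(\lambda)}$). $X$ has paths of bounded variation iff $\sigma=0$ and $\int_0^1 z\,\Pi(dz)<\infty$; in that case its drift is $c:=\gamma+\int_0^1z\,\Pi(dz)$. The SDE is understood in integral form, $U_k(t)=X(t)-\sum_{i=1}^k\delta_i\int_0^t\mathbf 1_{\{U_k(s)>b_i\}}\,ds$ for all $t\ge 0$ (so $U_k(0)=X(0)$); a strong solution is a process adapted to the filtration of $X$ satisfying this almost surely, and uniqueness means pathwise uniqueness (two solutions are indistinguishable). *)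

theory Defs
  imports "HOL-Probability.Probability"
begin

definition cadlag :: "(real \<Rightarrow> real) \<Rightarrow> bool" where
  "cadlag f \<longleftrightarrow>
     (\<forall>t\<ge>0. continuous (at_right t) f) \<and> (\<forall>t>0. \<exists>l. (f \<longlongrightarrow> l) (at_left t))"

definition locally_bounded_variation :: "(real \<Rightarrow> real) \<Rightarrow> bool" where
  "locally_bounded_variation f \<longleftrightarrow>
     (\<forall>T\<ge>0. \<exists>B. \<forall>n (t :: nat \<Rightarrow> real).
        mono_on {..n} t \<and> t ` {..n} \<subseteq> {0..T} \<longrightarrow>
        (\<Sum>i<n. \<bar>f (t (Suc i)) - f (t i)\<bar>) \<le> B)"

text \<open>
  Time is the half-line \<^term>\<open>{0..} :: real set\<close>. Processes and filtrations are indexed by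
  \<^typ>\<open>real\<close>, but path properties only concern nonnegative times, and a filtration indexed by
  the half-line extends to negative times by its value at 0. No usual conditions are imposed.
  A process is Levy with respect to \<open>F\<close>; the filtration generated by \<open>X\<close>, raw or augmented
  by null sets, is a special case.
\<close>

locale levy_process = prob_space M + filtration "space M" F
  for M :: "'a measure" and F :: "real \<Rightarrow> 'a measure" +
  fixes X :: "real \<Rightarrow> 'a \<Rightarrow> real" and x :: real
  assumes subalgebra_F: "\<And>t. subalgebra M (F t)"
    and adapted: "\<And>t. 0 \<le> t \<Longrightarrow> X t \<in> borel_measurable (F t)"
    and start: "AE \<omega> in M. X 0 \<omega> = x"
    and indep_increments: "\<And>s t. 0 \<le> s \<Longrightarrow> s \<le> t \<Longrightarrow>
          indep_set (sets (F s)) (sets (vimage_algebra (space M) (\<lambda>\<omega>. X t \<omega> - X s \<omega>) borel))"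
    and stationary_increments: "\<And>s t. 0 \<le> s \<Longrightarrow> s \<le> t \<Longrightarrow>
          distr M borel (\<lambda>\<omega>. X t \<omega> - X s \<omega>) = distr M borel (\<lambda>\<omega>. X (t - s) \<omega> - X 0 \<omega>)"
    and cadlag_paths: "AE \<omega> in M. cadlag (\<lambda>t. X t \<omega>)"

text \<open>
  The measure \<open>\<nu>\<close> lives on the positive half-line: it describes the sizes of the downward jumps.
\<close>

definition laplace_exponent :: "real \<Rightarrow> real \<Rightarrow> real measure \<Rightarrow> real \<Rightarrow> real" where
  "laplace_exponent \<gamma> \<sigma> \<nu> l =
     \<gamma> * l + \<sigma>\<^sup>2 * l\<^sup>2 / 2 +
     (LINT z:{0<..}|\<nu>. exp (- l * z) - 1 + l * z * indicator {0<..<1} z)"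

locale spectrally_negative_levy_process = levy_process M F X x
  for M :: "'a measure" and F :: "real \<Rightarrow> 'a measure"
    and X :: "real \<Rightarrow> 'a \<Rightarrow> real" and x :: real +
  fixes \<gamma> \<sigma> :: real and \<nu> :: "real measure"
  assumes no_positive_jumps:
      "AE \<omega> in M. \<forall>t>0. X t \<omega> \<le> Lim (at_left t) (\<lambda>s. X s \<omega>)"
    and not_monotone:
      "\<not> (AE \<omega> in M. mono_on {0..} (\<lambda>t. X t \<omega>) \<or> antimono_on {0..} (\<lambda>t. X t \<omega>))"
    and sigma_nonneg: "0 \<le> \<sigma>"
    and sets_nu: "sets \<nu> = sets borel"
    and nu_nonpos: "emeasure \<nu> {..0} = 0"
    and nu_integrable: "(\<integral>\<^sup>+ z. ennreal (min 1 (z\<^sup>2)) \<partial>\<nu>) < \<infinity>"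
    and laplace: "\<And>l t. 0 \<le> l \<Longrightarrow> 0 \<le> t \<Longrightarrow>
      has_bochner_integral M (\<lambda>\<omega>. exp (l * (X t \<omega> - x))) (exp (t * laplace_exponent \<gamma> \<sigma> \<nu> l))"

definition bounded_variation_paths :: "'a measure \<Rightarrow> (real \<Rightarrow> 'a \<Rightarrow> real) \<Rightarrow> bool" where
  "bounded_variation_paths M X \<longleftrightarrow> (AE \<omega> in M. locally_bounded_variation (\<lambda>t. X t \<omega>))"

text \<open>
  Only meaningful in the bounded variation case, where \<open>z\<close> is \<open>\<nu>\<close>-integrable on the unit interval.
\<close>

definition levy_drift :: "real \<Rightarrow> real measure \<Rightarrow> real" where
  "levy_drift \<gamma> \<nu> = \<gamma> + (LINT z:{0<..<1}|\<nu>. z)"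

text \<open>
  The integrability clause makes the time integrals in the equation meaningful: the Bochner
  integral of a function that is not measurable would silently be 0.
\<close>

definition strong_solution ::
  "'a measure \<Rightarrow> (real \<Rightarrow> 'a measure) \<Rightarrow> (real \<Rightarrow> 'a \<Rightarrow> real) \<Rightarrow>
   nat \<Rightarrow> (nat \<Rightarrow> real) \<Rightarrow> (nat \<Rightarrow> real) \<Rightarrow> (real \<Rightarrow> 'a \<Rightarrow> real) \<Rightarrow> bool" where
  "strong_solution M F X k \<delta> b U \<longleftrightarrow>
     (\<forall>t\<ge>0. U t \<in> borel_measurable (F t)) \<and>
     (AE \<omega> in M. \<forall>t\<ge>0.
        (\<forall>i\<in>{1..k}. set_integrable lborel {0..t} (\<lambda>s. indicat_real {b i<..} (U s \<omega>))) \<and>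
        U t \<omega> = X t \<omega> -
          (\<Sum>i=1..k. \<delta> i * (LBINT s:{0..t}. indicat_real {b i<..} (U s \<omega>))))"

definition indistinguishable ::
  "'a measure \<Rightarrow> (real \<Rightarrow> 'a \<Rightarrow> real) \<Rightarrow> (real \<Rightarrow> 'a \<Rightarrow> real) \<Rightarrow> bool" where
  "indistinguishable M U V \<longleftrightarrow> (AE \<omega> in M. \<forall>t\<ge>0. U t \<omega> = V t \<omega>)"

end

theory Submission
  imports Defs
begin

text \<open>
  Put \<open>\<phi> u = (\<Sum>i. \<delta> i * indicator {b i<..} u)\<close> and \<open>\<Delta> = (\<Sum>i. \<delta> i)\<close>. Uniqueness is pathwise: since
  \<open>\<phi>\<close> is nondecreasing, the continuous difference of two solutions cannot move away from 0.

  For existence, the same monotonicity makes the Euler scheme converge along every path whose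
  discontinuities are countable, to \<open>X + V\<close> with \<open>V\<close> decreasing at rate at most \<open>\<Delta>\<close>. This limit
  is adapted without any completion of the filtration, and it solves the equation as soon as it spends no
  time at the levels \<open>b i\<close>. If it is at \<open>b i\<close> at the times \<open>s\<close> and \<open>s + u\<close>, the increment of \<open>X\<close> over
  this period lies in \<open>[0, \<Delta> u]\<close>, so it suffices that the probability of this event does not tend to 1
  as \<open>u \<rightarrow> 0\<close>. That follows from exponential moments, because \<open>\<psi> l / l\<close> stays above \<open>\<Delta>\<close> for large \<open>l\<close>:
  it tends to infinity unless \<open>\<sigma> = 0\<close> and the small jumps are summable, in which case the paths have bounded
  variation and the limit is the drift.
\<close>

section \<open>Pathwise analysis\<close>

text \<open>The obstacle is that \<open>\<phi>\<close> jumps exactly at the levels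
  \<open>b i\<close>: no Lipschitz estimate is available, and the limit of the scheme need not
  commute with \<open>\<phi>\<close> while it sits at a level. Sticking does happen in general: for
  the driver \<open>c * t\<close> with one level and \<open>0 < c < \<Delta>\<close>, the Euler
  limit stays at the level once it is there, and the equation has no solution. Zero occupation time
  is therefore the place where the assumption on the drift enters. The moment argument needs two
  exponents. On the time scale \<open>u = 1 / \<psi> n\<close> the variable
  \<open>exp (n * (X u - x))\<close> has mean \<open>e\<close> but stays below a constant smaller
  than \<open>e\<close> on a sticking increment. The rest of the mean cannot come from an event of
  vanishing probability, since the second moment \<open>exp (u * \<psi> (2 * n))\<close> stays
  bounded; this is why \<open>\<psi> (2 * l)\<close> is compared with \<open>\<psi> l\<close>. That
  summable small jumps and \<open>\<sigma> = 0\<close> give paths of bounded variation is also read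
  off from exponential moments: they force every increment to be at most the drift times the elapsed
  time.\<close>

lemma set_integrable_lborel_bounded:
  fixes f :: "real \<Rightarrow> real"
  assumes "f \<in> borel_measurable borel" "\<And>s. \<bar>f s\<bar> \<le> B"
  shows "set_integrable lborel {a..b} f"
proof -
  have "set_integrable lborel {a..b} (\<lambda>_. B)"
    unfolding set_integrable_def
    by (cases "a \<le> b") (auto intro!: integrable_real_indicator simp: emeasure_lborel_Icc_eq)
  then show ?thesis
    by (rule set_integrable_bound)
      (use assms in \<open>auto simp: set_borel_measurable_def intro!: order_trans[OF assms(2)]\<close>)
qed

lemma set_integral_lborel_split:
  fixes f :: "real \<Rightarrow> real"
  assumes "set_integrable lborel {a..c} f" "a \<le> b" "b \<le> c"
  shows "(LBINT s:{a..c}. f s) = (LBINT s:{a..b}. f s) + (LBINT s:{b..c}. f s)"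
proof -
  have sub: "set_integrable lborel {a..b} f" "set_integrable lborel {b..c} f"
    using assms by (auto intro: set_integrable_subset)
  have "f integrable_on {a..c}"
    using assms(1) by (rule set_borel_integral_eq_integral)
  then show ?thesis
    using assms sub by (simp add: set_borel_integral_eq_integral Henstock_Kurzweil_Integration.integral_combine)
qed

text \<open>One-sided limits at \<open>t\<close> make the oscillation of \<open>f\<close> small
  around all points close to \<open>t\<close> and different from it. So for each \<open>e\<close>
  the points of oscillation at least \<open>e\<close> do not accumulate in the open half-line, and
  there are countably many; discontinuities are the union over \<open>e = 1 / Suc n\<close>.\<close>

lemma countable_not_isCont_cadlag:
  assumes "cadlag f"
  shows "countable {t. 0 < t \<and> \<not> isCont f t}"
proof -
  define osc where "osc e t \<longleftrightarrow> (\<exists>d>0. \<forall>u\<in>ball t d. \<forall>v\<in>ball t d. \<bar>f u - f v\<bar> < e)" for e t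
  have one_sided: "\<exists>d>0. \<forall>s. 0 < \<bar>s - t\<bar> \<and> \<bar>s - t\<bar> < d \<and> (s < t \<longleftrightarrow> left) \<longrightarrow> osc e s"
    if lim: "(f \<longlongrightarrow> l) (if left then at_left t else at_right t)" and "0 < e" for l e left t
  proof -
    have "eventually (\<lambda>s. \<bar>f s - l\<bar> < e / 2) (if left then at_left t else at_right t)"
      using tendstoD[OF lim, of "e / 2"] \<open>0 < e\<close> by (simp add: dist_real_def)
    then obtain d where d: "d > 0"
      "\<And>s. 0 < \<bar>s - t\<bar> \<Longrightarrow> \<bar>s - t\<bar> < d \<Longrightarrow> (s < t \<longleftrightarrow> left) \<Longrightarrow> \<bar>f s - l\<bar> < e / 2"
      by (cases left) (auto simp: eventually_at dist_real_def)
    have "osc e s" if s: "0 < \<bar>s - t\<bar>" "\<bar>s - t\<bar> < d" "s < t \<longleftrightarrow> left" for s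
      unfolding osc_def
    proof (intro exI conjI ballI)
      \<comment> \<open>A ball of this radius around \<open>s\<close> stays on the same side of
        \<open>t\<close> as \<open>s\<close> and within distance \<open>d\<close> of
        \<open>t\<close>.\<close>
      show "min \<bar>s - t\<bar> (d - \<bar>s - t\<bar>) > 0"
        using s by auto
      fix u v assume "u \<in> ball s (min \<bar>s - t\<bar> (d - \<bar>s - t\<bar>))" "v \<in> ball s (min \<bar>s - t\<bar> (d - \<bar>s - t\<bar>))"
      then have "0 < \<bar>u - t\<bar>" "\<bar>u - t\<bar> < d" "u < t \<longleftrightarrow> left" "0 < \<bar>v - t\<bar>" "\<bar>v - t\<bar> < d" "v < t \<longleftrightarrow> left"
        using s by (auto simp: dist_real_def)
      then show "\<bar>f u - f v\<bar> < e"
        using d(2)[of u] d(2)[of v] by argo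
    qed
    then show ?thesis
      using d(1) by blast
  qed
  have "countable ({0<..} \<inter> {t. \<not> osc e t})" if e: "0 < e" for e
  proof (rule sparse_imp_countable)
    show "{t. \<not> osc e t} sparse_in {0<..}"
      unfolding sparse_in_eventually_iff[OF open_greaterThan]
    proof (intro ballI)
      fix t :: real assume "t \<in> {0<..}"
      then have "0 < t" by simp
      then obtain l where "(f \<longlongrightarrow> l) (at_left t)" "(f \<longlongrightarrow> f t) (at_right t)"
        using assms unfolding cadlag_def continuous_within by (meson less_imp_le)
      then obtain d1 d2 where d: "d1 > 0" "d2 > 0"
        "\<forall>s. 0 < \<bar>s - t\<bar> \<and> \<bar>s - t\<bar> < d1 \<and> (s < t \<longleftrightarrow> True) \<longrightarrow> osc e s"
        "\<forall>s. 0 < \<bar>s - t\<bar> \<and> \<bar>s - t\<bar> < d2 \<and> (s < t \<longleftrightarrow> False) \<longrightarrow> osc e s"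
        using one_sided[of l True t e] one_sided[of "f t" False t e] e by auto
      have "\<forall>y. y \<noteq> t \<and> dist y t < min d1 d2 \<longrightarrow> y \<notin> {t. \<not> osc e t}"
        using d(3,4) by (auto simp: dist_real_def)
      then show "\<forall>\<^sub>F y in at t. y \<notin> {t. \<not> osc e t}"
        unfolding eventually_at using d(1,2) by (intro exI[of _ "min d1 d2"]) auto
    qed
  qed simp
  then have "countable (\<Union>n. {0<..} \<inter> {t. \<not> osc (1 / real (Suc n)) t})"
    by (intro countable_UN countableI_type) simp
  moreover have "{t. 0 < t \<and> \<not> isCont f t} \<subseteq> (\<Union>n. {0<..} \<inter> {t. \<not> osc (1 / real (Suc n)) t})"
  proof safe
    fix t :: real assume "0 < t" "\<not> isCont f t"
    have "isCont f t" if all: "\<And>n. osc (1 / real (Suc n)) t"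
      unfolding continuous_at_eps_delta
    proof (intro allI impI)
      fix e :: real assume "0 < e"
      then obtain n where n: "1 / real (Suc n) < e"
        using nat_approx_posE by blast
      obtain d where "d > 0" "\<forall>u\<in>ball t d. \<forall>v\<in>ball t d. \<bar>f u - f v\<bar> < 1 / real (Suc n)"
        using all unfolding osc_def by blast
      then show "\<exists>d>0. \<forall>x'. dist x' t < d \<longrightarrow> dist (f x') (f t) < e"
        using n by (intro exI[of _ d]) (metis centre_in_ball dist_commute dist_real_def mem_ball order.strict_trans)
    qed
    with \<open>\<not> isCont f t\<close> \<open>0 < t\<close> show "t \<in> (\<Union>n. {0<..} \<inter> {t. \<not> osc (1 / real (Suc n)) t})"
      by auto
  qed
  ultimately show ?thesis
    using countable_subset by blast
qed

text \<open>Last-crossing argument: after the last time at which the integral of \<open>d\<close> is at most \<open>e\<close>,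
  its growth is controlled by \<open>g\<close>.\<close>

lemma integral_le_of_last_crossing:
  fixes d g :: "real \<Rightarrow> real"
  assumes d: "set_integrable lborel {0..T} d" and g: "set_integrable lborel {0..T} g"
    and g_nonneg: "\<And>s. 0 \<le> g s" and "0 \<le> e" "0 \<le> T"
    and le: "\<And>s. s \<in> {0..T} \<Longrightarrow> e < (LBINT r:{0..s}. d r) \<Longrightarrow> d s \<le> g s"
  shows "(LBINT r:{0..T}. d r) \<le> e + (LBINT r:{0..T}. g r)"
proof -
  define D where "D t = (LBINT r:{0..t}. d r)" for t
  have sub: "set_integrable lborel {a..b} d" "set_integrable lborel {a..b} g" if "0 \<le> a" "b \<le> T" for a b
    using d g that by (auto intro: set_integrable_subset)
  have D_eq: "D t = integral {0..t} d" if "t \<in> {0..T}" for t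
    unfolding D_def using that sub[of 0 t] by (simp add: set_borel_integral_eq_integral)
  have "continuous_on {0..T} (\<lambda>t. integral {0..t} d)"
    using d by (intro indefinite_integral_continuous_1 set_borel_integral_eq_integral)
  then have cont: "continuous_on {0..T} D"
    by (rule continuous_on_eq) (simp add: D_eq)
  define S where "S = {t\<in>{0..T}. D t \<le> e}"
  have "compact S"
    unfolding compact_eq_bounded_closed
  proof
    show "bounded S"
      by (rule bounded_subset[OF bounded_closed_interval]) (auto simp: S_def)
    have "S = {0..T} \<inter> D -` {..e}"
      by (auto simp: S_def)
    then show "closed S"
      using continuous_closed_preimage[OF cont closed_atLeastAtMost closed_atMost] by simp
  qed
  moreover have "0 \<in> S"
    using assms(4,5) D_eq[of 0] by (simp add: S_def)
  ultimately obtain s0 where s0: "s0 \<in> S" "\<And>t. t \<in> S \<Longrightarrow> t \<le> s0"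
    using compact_attains_sup[of S] by blast
  then have s0_ivl: "0 \<le> s0" "s0 \<le> T" and Ds0: "D s0 \<le> e"
    by (auto simp: S_def)
  have "D T = D s0 + (LBINT r:{s0..T}. d r)"
    unfolding D_def using set_integral_lborel_split[OF d s0_ivl] by simp
  also have "(LBINT r:{s0..T}. d r) \<le> (LBINT r:{s0..T}. g r)"
  proof (rule set_integral_mono_AE)
    \<comment> \<open>The comparison of \<open>d\<close> with \<open>g\<close> is available only
      strictly after \<open>s0\<close>; the single point \<open>s0\<close> does not affect the
      integral.\<close>
    have "AE r in lborel. r \<noteq> s0"
      by (rule AE_lborel_singleton)
    then show "AE r \<in> {s0..T} in lborel. d r \<le> g r"
    proof eventually_elim
      case (elim r)
      show ?case
      proof
        assume r: "r \<in> {s0..T}"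
        with elim s0(2)[of r] s0_ivl have "r \<notin> S" by force
        with r s0_ivl show "d r \<le> g r"
          by (intro le) (auto simp: S_def D_def)
      qed
    qed
  qed (use sub s0_ivl in auto)
  also have "(LBINT r:{s0..T}. g r) \<le> (LBINT r:{0..T}. g r)"
    using set_integral_lborel_split[OF g s0_ivl] g_nonneg
    by (simp add: set_lebesgue_integral_def integral_nonneg_AE)
  finally show ?thesis
    using Ds0 by (simp add: D_def)
qed

lemma nat_floor_cell:
  fixes h s :: real
  assumes "0 < h" "h * real j \<le> s" "s < h * real (Suc j)"
  shows "nat \<lfloor>s / h\<rfloor> = j"
proof -
  have "\<lfloor>s / h\<rfloor> = int j"
    using assms by (intro floor_unique) (simp_all add: field_simps)
  then show ?thesis by simp
qed

lemma grid_bounds: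
  fixes h s :: real
  assumes "0 < h" "0 \<le> s"
  shows "h * real (nat \<lfloor>s / h\<rfloor>) \<le> s" "s < h * real (nat \<lfloor>s / h\<rfloor>) + h"
proof -
  have j: "real (nat \<lfloor>s / h\<rfloor>) = real_of_int \<lfloor>s / h\<rfloor>"
    using assms by simp
  have "h * real_of_int \<lfloor>s / h\<rfloor> \<le> h * (s / h)" "h * (s / h) < h * (real_of_int \<lfloor>s / h\<rfloor> + 1)"
    using assms(1) by (intro mult_left_mono mult_strict_left_mono; linarith)+
  then show "h * real (nat \<lfloor>s / h\<rfloor>) \<le> s" "s < h * real (nat \<lfloor>s / h\<rfloor>) + h"
    unfolding j using assms(1) by (simp_all add: distrib_left)
qed

section \<open>The Euler scheme for a bounded nondecreasing drift, continuous or not\<close>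

locale bounded_mono =
  fixes \<phi> :: "real \<Rightarrow> real" and \<Delta> :: real
  assumes mono: "mono \<phi>" and nonneg: "0 \<le> \<phi> u" and le_bound: "\<phi> u \<le> \<Delta>"
begin

lemma bound_nonneg: "0 \<le> \<Delta>"
  using nonneg[of 0] le_bound[of 0] by simp

lemma borel_measurable_phi [measurable]: "\<phi> \<in> borel_measurable borel"
  using mono by (rule borel_measurable_mono)

text \<open>\<open>u - v\<close> is the integral of \<open>\<phi> (v s) - \<phi> (u s)\<close>, and
  by monotonicity this integrand is nonpositive as long as \<open>u - v\<close> is positive: the
  last-crossing bound with \<open>e = 0\<close> and \<open>g = 0\<close>. The driver
  \<open>f\<close> cancels, so it needs no regularity. Exchanging \<open>u\<close> and
  \<open>v\<close> gives uniqueness.\<close>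

lemma integral_equation_le:
  fixes u v f :: "real \<Rightarrow> real"
  assumes "0 \<le> T"
    and u: "set_integrable lborel {0..T} (\<lambda>s. \<phi> (u s))"
      "\<And>t. t \<in> {0..T} \<Longrightarrow> u t = f t - (LBINT s:{0..t}. \<phi> (u s))"
    and v: "set_integrable lborel {0..T} (\<lambda>s. \<phi> (v s))"
      "\<And>t. t \<in> {0..T} \<Longrightarrow> v t = f t - (LBINT s:{0..t}. \<phi> (v s))"
  shows "u T \<le> v T"
proof -
  have diff: "(LBINT s:{0..t}. \<phi> (v s) - \<phi> (u s)) = u t - v t" if "t \<in> {0..T}" for t
  proof -
    have "set_integrable lborel {0..t} (\<lambda>s. \<phi> (u s))"
      by (rule set_integrable_subset[OF u(1)]) (use that in auto)
    moreover have "set_integrable lborel {0..t} (\<lambda>s. \<phi> (v s))"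
      by (rule set_integrable_subset[OF v(1)]) (use that in auto)
    ultimately show ?thesis
      using u(2)[OF that] v(2)[OF that] by simp
  qed
  have "(LBINT s:{0..T}. \<phi> (v s) - \<phi> (u s)) \<le> 0 + (LBINT s:{0..T}. 0)"
  proof (rule integral_le_of_last_crossing)
    show "set_integrable lborel {0..T} (\<lambda>s. \<phi> (v s) - \<phi> (u s))"
      using v(1) u(1) by (rule set_integral_diff)
    show "set_integrable lborel {0..T} (\<lambda>s. 0 :: real)"
      by (simp add: set_integrable_def)
    fix s assume "s \<in> {0..T}" "0 < (LBINT r:{0..s}. \<phi> (v r) - \<phi> (u r))"
    then have "v s \<le> u s"
      using diff by simp
    then show "\<phi> (v s) - \<phi> (u s) \<le> 0"
      using mono by (simp add: monoD)
  qed (use assms in auto)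
  then show ?thesis
    using diff[of T] assms(1) by simp
qed

text \<open>Only the accumulated drift is discretized; the approximate solution is \<open>f\<close>
  plus this. The drift part is Lipschitz uniformly in \<open>h\<close>, however rough
  \<open>f\<close> is.\<close>

fun euler :: "(real \<Rightarrow> real) \<Rightarrow> real \<Rightarrow> nat \<Rightarrow> real" where
  "euler f h 0 = 0"
| "euler f h (Suc j) = euler f h j - h * \<phi> (f (h * real j) + euler f h j)"

definition euler_path :: "(real \<Rightarrow> real) \<Rightarrow> real \<Rightarrow> real \<Rightarrow> real" where
  "euler_path f h t = (let j = nat \<lfloor>t / h\<rfloor> in
     euler f h j - (t - h * real j) * \<phi> (f (h * real j) + euler f h j))"

definition euler_slope :: "(real \<Rightarrow> real) \<Rightarrow> real \<Rightarrow> real \<Rightarrow> real" where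
  "euler_slope f h s = (let j = nat \<lfloor>s / h\<rfloor> in \<phi> (f (h * real j) + euler f h j))"

lemma euler_slope_has_integral_cell:
  assumes "0 < h" "h * real j \<le> t" "t \<le> h * real (Suc j)"
  shows "(euler_slope f h has_integral (t - h * real j) * \<phi> (f (h * real j) + euler f h j)) {h * real j..t}"
\<comment> \<open>At the right end of the cell the floor has already moved on, so the slope is
  constant only away from this point.\<close>
proof (rule has_integral_spike_finite[of "{h * real (Suc j)}"])
  show "((\<lambda>_. \<phi> (f (h * real j) + euler f h j)) has_integral
      (t - h * real j) * \<phi> (f (h * real j) + euler f h j)) {h * real j..t}"
    using has_integral_const_real[of "\<phi> (f (h * real j) + euler f h j)" "h * real j" t] assms by simp
  fix s assume "s \<in> {h * real j..t} - {h * real (Suc j)}"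
  then have "nat \<lfloor>s / h\<rfloor> = j"
    using assms by (intro nat_floor_cell) auto
  then show "euler_slope f h s = \<phi> (f (h * real j) + euler f h j)"
    by (simp add: euler_slope_def)
qed simp

lemma euler_slope_has_integral_grid:
  assumes "0 < h"
  shows "(euler_slope f h has_integral - euler f h j) {0..h * real j}"
proof (induction j)
  case (Suc j)
  have "(euler_slope f h has_integral
      - euler f h j + (h * real (Suc j) - h * real j) * \<phi> (f (h * real j) + euler f h j)) {0..h * real (Suc j)}"
    by (rule has_integral_combine[OF _ _ Suc.IH euler_slope_has_integral_cell]) (use assms in auto)
  then show ?case
    by (simp add: algebra_simps)
qed (simp add: has_integral_refl)

lemma borel_measurable_euler_slope [measurable]: "euler_slope f h \<in> borel_measurable borel"
proof -
  have "(\<lambda>s. (\<lambda>j. \<phi> (f (h * real j) + euler f h j)) (nat \<lfloor>s / h\<rfloor>)) \<in> borel_measurable borel"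
    by measurable
  then show ?thesis
    by (simp add: euler_slope_def[abs_def] Let_def)
qed

lemma euler_slope_bounds: "euler_slope f h s \<in> {0..\<Delta>}"
  by (simp add: euler_slope_def Let_def nonneg le_bound)

lemma set_integrable_euler_slope: "set_integrable lborel {a..b} (euler_slope f h)"
  by (rule set_integrable_lborel_bounded[where B = \<Delta>])
    (auto simp: euler_slope_def Let_def nonneg le_bound)

lemma euler_path_eq_integral:
  assumes "0 < h" "0 \<le> t"
  shows "euler_path f h t = - (LBINT s:{0..t}. euler_slope f h s)"
proof -
  define j where "j = nat \<lfloor>t / h\<rfloor>"
  have "h * real j \<le> t" "t \<le> h * real (Suc j)"
    using grid_bounds[OF assms] unfolding j_def by (simp_all add: algebra_simps)
  then have "(euler_slope f h has_integral
      - euler f h j + (t - h * real j) * \<phi> (f (h * real j) + euler f h j)) {0..t}"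
    by (intro has_integral_combine[OF _ _ euler_slope_has_integral_grid euler_slope_has_integral_cell])
      (use assms in auto)
  then have "(euler_slope f h has_integral - euler_path f h t) {0..t}"
    by (simp add: euler_path_def Let_def j_def[symmetric])
  then show ?thesis
    using set_borel_integral_eq_integral(2)[OF set_integrable_euler_slope] by (simp add: integral_unique)
qed

lemma euler_path_diff:
  assumes "0 < h" "0 \<le> s" "s \<le> t"
  shows "euler_path f h t - euler_path f h s \<in> {- \<Delta> * (t - s)..0}"
proof -
  have eq: "euler_path f h t - euler_path f h s = - (LBINT r:{s..t}. euler_slope f h r)"
    using set_integral_lborel_split[OF set_integrable_euler_slope, of 0 s t f h] assms
    by (simp add: euler_path_eq_integral)
  have "0 \<le> (LBINT r:{s..t}. euler_slope f h r)"
    by (auto simp: set_lebesgue_integral_def euler_slope_def Let_def nonneg intro!: integral_nonneg_AE)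
  moreover have "(LBINT r:{s..t}. euler_slope f h r) \<le> (LBINT r:{s..t}. \<Delta>)"
    by (intro set_integral_mono set_integrable_euler_slope set_integrable_lborel_bounded[where B = "\<bar>\<Delta>\<bar>"])
      (auto simp: euler_slope_def Let_def le_bound)
  moreover have "(LBINT r:{s..t}. \<Delta>) = \<Delta> * (t - s)"
    using assms by (simp add: set_lebesgue_integral_def)
  ultimately show ?thesis
    unfolding eq by simp
qed

text \<open>At a grid point the interpolation term of \<open>euler_path\<close> vanishes. The slope
  thus becomes \<open>\<phi>\<close> of the approximate solution at the last grid point, the form in
  which two step sizes can be compared.\<close>

lemma euler_slope_eq:
  assumes "0 < h"
  defines "g \<equiv> \<lambda>s. h * real (nat \<lfloor>s / h\<rfloor>)"
  shows "euler_slope f h s = \<phi> (f (g s) + euler_path f h (g s))"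
proof -
  have "nat \<lfloor>g s / h\<rfloor> = nat \<lfloor>s / h\<rfloor>"
    unfolding g_def using assms(1) by (intro nat_floor_cell) auto
  then show ?thesis
    by (simp add: euler_slope_def euler_path_def Let_def g_def)
qed

abbreviation step :: "nat \<Rightarrow> real" where
  "step n \<equiv> 1 / real (Suc n)"

abbreviation grid :: "nat \<Rightarrow> real \<Rightarrow> real" where
  "grid n s \<equiv> step n * real (nat \<lfloor>s / step n\<rfloor>)"

lemma step_tendsto: "step \<longlonglongrightarrow> 0"
  using LIMSEQ_inverse_real_of_nat by (simp add: inverse_eq_divide)

lemma grid_tendsto:
  assumes "0 \<le> s"
  shows "(\<lambda>n. grid n s) \<longlonglongrightarrow> s"
proof (rule real_tendsto_sandwich[of "\<lambda>n. s - step n" _ _ "\<lambda>_. s"])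
  have "grid n s \<le> s" "s < grid n s + step n" for n
    using grid_bounds[OF _ assms, of "step n"] by simp_all
  then show "\<forall>\<^sub>F n in sequentially. s - step n \<le> grid n s" "\<forall>\<^sub>F n in sequentially. grid n s \<le> s"
    by (auto intro!: always_eventually less_imp_le simp del: of_nat_Suc simp: diff_less_eq)
  show "(\<lambda>n. s - step n) \<longlonglongrightarrow> s"
    using tendsto_diff[OF tendsto_const step_tendsto, of s] by simp
qed simp

text \<open>\<open>lim\<close> takes one fixed value on all divergent sequences, so this is
  measurable in the path without any knowledge of convergence. No exceptional null set has to be
  removed, hence none has to belong to the filtration.\<close>

definition euler_limit :: "(real \<Rightarrow> real) \<Rightarrow> real \<Rightarrow> real" where
  "euler_limit f t = lim (\<lambda>n. euler_path f (step n) t)"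

lemma borel_measurable_euler:
  assumes "\<And>i. i \<le> j \<Longrightarrow> (\<lambda>\<omega>. f \<omega> (h * real i)) \<in> borel_measurable N"
  shows "(\<lambda>\<omega>. euler (f \<omega>) h j) \<in> borel_measurable N"
  using assms
proof (induction j)
  case (Suc j)
  then have [measurable]: "(\<lambda>\<omega>. f \<omega> (h * real j)) \<in> borel_measurable N"
    "(\<lambda>\<omega>. euler (f \<omega>) h j) \<in> borel_measurable N"
    by auto
  show ?case by simp
qed simp

text \<open>The value at \<open>t\<close> reads \<open>f\<close> only at grid points not exceeding
  \<open>t\<close>. This is what turns measurability into adaptedness when \<open>N\<close> is the
  sigma-algebra at time \<open>t\<close>.\<close>

lemma borel_measurable_euler_path:
  assumes f: "\<And>s. 0 \<le> s \<Longrightarrow> s \<le> t \<Longrightarrow> (\<lambda>\<omega>. f \<omega> s) \<in> borel_measurable N"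
    and "0 < h" "0 \<le> t"
  shows "(\<lambda>\<omega>. euler_path (f \<omega>) h t) \<in> borel_measurable N"
proof -
  define j where "j = nat \<lfloor>t / h\<rfloor>"
  have f_grid: "(\<lambda>\<omega>. f \<omega> (h * real i)) \<in> borel_measurable N" if "i \<le> j" for i
  proof (rule f)
    have "h * real i \<le> h * real j"
      using that \<open>0 < h\<close> by simp
    also have "\<dots> \<le> t"
      unfolding j_def using assms(2,3) by (rule grid_bounds)
    finally show "h * real i \<le> t" .
  qed (use \<open>0 < h\<close> in simp)
  then have [measurable]: "(\<lambda>\<omega>. f \<omega> (h * real j)) \<in> borel_measurable N"
    "(\<lambda>\<omega>. euler (f \<omega>) h j) \<in> borel_measurable N"
    by (auto intro: borel_measurable_euler)
  show ?thesis
    unfolding euler_path_def Let_def j_def[symmetric] by measurable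
qed

lemma borel_measurable_euler_limit:
  assumes "\<And>s. 0 \<le> s \<Longrightarrow> s \<le> t \<Longrightarrow> (\<lambda>\<omega>. f \<omega> s) \<in> borel_measurable N" "0 \<le> t"
  shows "(\<lambda>\<omega>. euler_limit (f \<omega>) t) \<in> borel_measurable N"
  unfolding euler_limit_def
  by (intro borel_measurable_lim_metric borel_measurable_euler_path assms) simp_all

section \<open>Convergence along a driver with countably many discontinuities\<close>

context
  fixes f :: "real \<Rightarrow> real"
  assumes countable_discont: "countable {t. \<not> isCont f t}"
begin

lemma borel_measurable_driver [measurable]: "f \<in> borel_measurable borel"
  using countable_discont
  by (rule borel_measurable_continuous_countable_exceptions) (auto intro: continuous_at_imp_continuous_on)

lemma AE_isCont_driver: "AE s in lborel. isCont f s"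
  using AE_not_in[OF countable_imp_null_set_lborel[OF countable_discont]] by simp

text \<open>The Cauchy property follows from comparing two step sizes. Where \<open>f\<close> is
  well approximated by its values at both grids, a gap above \<open>4 * e\<close> between the two
  paths forces the arguments of \<open>\<phi>\<close> into the same order, so by monotonicity the
  gap does not grow. The remaining times form sets whose measure vanishes, because \<open>f\<close>
  is continuous almost everywhere.\<close>

lemma euler_path_convergent:
  assumes "0 \<le> t"
  shows "(\<lambda>n. euler_path f (step n) t) \<longlonglongrightarrow> euler_limit f t"
proof -
  define bad where "bad e n = {s. e < \<bar>f (grid n s) - f s\<bar>}" for e n
  define \<mu> where "\<mu> e n = (LBINT s:{0..t}. indicat_real (bad e n) s)" for e n
  have bad [measurable]: "bad e n \<in> sets borel" for e n
    unfolding bad_def by measurable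
  have int_bad: "set_integrable lborel {0..b} (indicat_real (bad e n))" for b e n
    by (rule set_integrable_lborel_bounded[where B = 1]) (auto simp: indicator_def)
  have mu_tendsto: "\<mu> e \<longlonglongrightarrow> 0" if "0 < e" for e
  proof -
    have "(\<lambda>n. \<mu> e n) \<longlonglongrightarrow> (LBINT s::real. 0)"
      unfolding \<mu>_def set_lebesgue_integral_def
    proof (rule integral_dominated_convergence[where w = "indicat_real {0..t}"])
      show "AE s in lborel. (\<lambda>n. indicat_real {0..t} s *\<^sub>R indicat_real (bad e n) s) \<longlonglongrightarrow> 0"
        using AE_isCont_driver
      proof eventually_elim
        case (elim s)
        show ?case
        proof (cases "s \<in> {0..t}")
          case True
          then have "(\<lambda>n. f (grid n s)) \<longlonglongrightarrow> f s"
            using elim grid_tendsto[of s] by (intro isCont_tendsto_compose[OF elim]) auto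
          then have "\<forall>\<^sub>F n in sequentially. dist (f (grid n s)) (f s) < e"
            using \<open>0 < e\<close> by (rule tendstoD)
          then have "\<forall>\<^sub>F n in sequentially. s \<notin> bad e n"
            by (rule eventually_mono) (simp add: bad_def dist_real_def)
          then have "\<forall>\<^sub>F n in sequentially. indicat_real {0..t} s *\<^sub>R indicat_real (bad e n) s = 0"
            by eventually_elim simp
          then show ?thesis
            by (rule tendsto_eventually)
        qed simp
      qed
    qed (use assms in \<open>auto simp: indicator_def intro!: integrable_real_indicator\<close>)
    then show ?thesis by simp
  qed
  have diff_le: "euler_path f (step n) t - euler_path f (step m) t \<le> 4 * e + \<Delta> * \<mu> e n + \<Delta> * \<mu> e m"
    if e: "0 < e" "\<Delta> * step n \<le> e" "\<Delta> * step m \<le> e" for n m e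
  proof -
    define d where "d s = euler_slope f (step m) s - euler_slope f (step n) s" for s
    define g where "g s = \<Delta> * indicat_real (bad e n) s + \<Delta> * indicat_real (bad e m) s" for s
    have D: "(LBINT r:{0..s}. d r) = euler_path f (step n) s - euler_path f (step m) s" if "0 \<le> s" for s
      unfolding d_def using that by (simp add: set_integrable_euler_slope euler_path_eq_integral)
    have "(LBINT r:{0..t}. d r) \<le> 4 * e + (LBINT r:{0..t}. g r)"
    proof (rule integral_le_of_last_crossing)
      show "set_integrable lborel {0..t} d" "set_integrable lborel {0..t} g"
        unfolding d_def g_def by (intro set_integral_diff set_integral_add set_integrable_euler_slope
          set_integrable_mult_right int_bad)+
      show "0 \<le> g s" for s
        using bound_nonneg by (simp add: g_def)
      fix s assume s: "s \<in> {0..t}" "4 * e < (LBINT r:{0..s}. d r)"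
      show "d s \<le> g s"
      proof (cases "s \<in> bad e n \<or> s \<in> bad e m")
        case True
        then have "\<Delta> \<le> g s"
          using bound_nonneg by (auto simp: g_def indicator_def)
        moreover have "d s \<le> \<Delta>"
          using euler_slope_bounds[of f "step m" s] euler_slope_bounds[of f "step n" s] by (simp add: d_def)
        ultimately show ?thesis by simp
      next
        case False
        have lag: "\<bar>euler_path f (step k) s - euler_path f (step k) (grid k s)\<bar> \<le> \<Delta> * step k" for k
        proof -
          have "grid k s \<le> s" "s - grid k s \<le> step k" "0 \<le> grid k s"
            using grid_bounds[of "step k" s] s by auto
          moreover from this have "\<Delta> * (s - grid k s) \<le> \<Delta> * step k"
            using bound_nonneg by (intro mult_left_mono)
          ultimately show ?thesis
            using euler_path_diff[of "step k" "grid k s" s f] by auto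
        qed
        \<comment> \<open>The allowance \<open>4 * e\<close> pays for two errors of \<open>f\<close>
          between \<open>s\<close> and its grid points, and for two lags of the Lipschitz paths,
          each at most \<open>e\<close>.\<close>
        have "f (grid m s) + euler_path f (step m) (grid m s) \<le> f (grid n s) + euler_path f (step n) (grid n s)"
          using False s e lag[of n] lag[of m] D[of s] unfolding bad_def by auto
        then have "d s \<le> 0"
          unfolding d_def using monoD[OF mono] by (simp add: euler_slope_eq)
        moreover have "0 \<le> g s"
          using bound_nonneg by (simp add: g_def)
        ultimately show ?thesis by simp
      qed
    qed (use assms e in auto)
    also have "(LBINT r:{0..t}. g r) = \<Delta> * \<mu> e n + \<Delta> * \<mu> e m"
      unfolding g_def \<mu>_def using int_bad by simp
    finally show ?thesis
      using D[OF assms] by simp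
  qed
  have "Cauchy (\<lambda>n. euler_path f (step n) t)"
    unfolding Cauchy_def dist_real_def
  proof (intro allI impI)
    fix r :: real assume "0 < r"
    \<comment> \<open>The bound is used in the form \<open>4 * e + e + e < r\<close>.\<close>
    define e where "e = r / 8"
    have e: "0 < e" using \<open>0 < r\<close> by (simp add: e_def)
    have "(\<lambda>n. \<Delta> * step n) \<longlonglongrightarrow> \<Delta> * 0" "(\<lambda>n. \<Delta> * \<mu> e n) \<longlonglongrightarrow> \<Delta> * 0"
      by (intro tendsto_mult tendsto_const step_tendsto mu_tendsto[OF e])+
    then have "\<forall>\<^sub>F n in sequentially. \<Delta> * step n < e \<and> \<Delta> * \<mu> e n < e"
      using e by (intro eventually_conj order_tendstoD(2)) auto
    then obtain N where N: "\<And>n. n \<ge> N \<Longrightarrow> \<Delta> * step n < e \<and> \<Delta> * \<mu> e n < e"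
      by (auto simp: eventually_sequentially)
    have "euler_path f (step n) t - euler_path f (step m) t < r" if "n \<ge> N" "m \<ge> N" for n m
      using diff_le[OF e, of n m] N[OF that(1)] N[OF that(2)] e by (simp add: e_def)
    then show "\<exists>N. \<forall>m\<ge>N. \<forall>n\<ge>N. \<bar>euler_path f (step m) t - euler_path f (step n) t\<bar> < r"
      by (intro exI[of _ N]) (auto simp: abs_less_iff)
  qed
  then show ?thesis
    unfolding euler_limit_def using Cauchy_convergent_iff convergent_LIMSEQ_iff by blast
qed

lemma euler_limit_diff:
  assumes "0 \<le> s" "s \<le> t"
  shows "euler_limit f t - euler_limit f s \<in> {- \<Delta> * (t - s)..0}"
proof (rule closed_sequentially[OF closed_atLeastAtMost])
  show "(\<lambda>n. euler_path f (step n) t - euler_path f (step n) s) \<longlonglongrightarrow> euler_limit f t - euler_limit f s"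
    using assms by (intro tendsto_diff euler_path_convergent) auto
  show "euler_path f (step n) t - euler_path f (step n) s \<in> {- \<Delta> * (t - s)..0}" for n
    using assms by (intro euler_path_diff) simp_all
qed

lemma euler_limit_continuous_on: "continuous_on {0..} (euler_limit f)"
proof (rule continuous_on_subset[OF lipschitz_on_continuous_on[of \<Delta>]])
  show "\<Delta>-lipschitz_on {0..} (euler_limit f)"
  proof (rule lipschitz_onI)
    fix s t :: real assume "s \<in> {0..}" "t \<in> {0..}"
    then show "dist (euler_limit f s) (euler_limit f t) \<le> \<Delta> * dist s t"
      using euler_limit_diff[of s t] euler_limit_diff[of t s]
      by (cases s t rule: le_cases) (auto simp: dist_real_def algebra_simps)
  qed (rule bound_nonneg)
qed simp

text \<open>Continuity of \<open>euler_limit f\<close> is known on the half-line only, so the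
  indicator is also inserted inside the argument of \<open>g\<close>, where it changes nothing on
  \<open>{0..t}\<close>.\<close>

lemma borel_measurable_indicator_solution:
  fixes g :: "real \<Rightarrow> real"
  assumes [measurable]: "g \<in> borel_measurable borel"
  shows "(\<lambda>s. indicat_real {0..t} s *\<^sub>R g (f s + euler_limit f s)) \<in> borel_measurable borel"
proof -
  have "continuous_on {0..t} (euler_limit f)"
    using euler_limit_continuous_on by (rule continuous_on_subset) auto
  then have [measurable]: "(\<lambda>s. indicat_real {0..t} s *\<^sub>R euler_limit f s) \<in> borel_measurable borel"
    by (intro borel_measurable_continuous_on_indicator) auto
  have "(\<lambda>s. indicat_real {0..t} s *\<^sub>R g (f s + indicat_real {0..t} s *\<^sub>R euler_limit f s)) \<in> borel_measurable borel"
    by measurable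
  also have "(\<lambda>s. indicat_real {0..t} s *\<^sub>R g (f s + indicat_real {0..t} s *\<^sub>R euler_limit f s)) =
      (\<lambda>s. indicat_real {0..t} s *\<^sub>R g (f s + euler_limit f s))"
    by (auto simp: indicator_def)
  finally show ?thesis .
qed

lemma set_integrable_solution:
  fixes g :: "real \<Rightarrow> real"
  assumes "g \<in> borel_measurable borel" "\<And>u. \<bar>g u\<bar> \<le> C"
  shows "set_integrable lborel {0..t} (\<lambda>s. g (f s + euler_limit f s))"
proof -
  have "set_integrable lborel {0..t} (\<lambda>_. C)"
    by (rule set_integrable_lborel_bounded[where B = "\<bar>C\<bar>"]) auto
  then show ?thesis
    by (rule set_integrable_bound)
      (use assms borel_measurable_indicator_solution[OF assms(1)] in
        \<open>auto simp: set_borel_measurable_def intro: order_trans[OF assms(2) abs_ge_self]\<close>)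
qed

text \<open>Dominated convergence in the integral form of the scheme. The hypothesis on
  \<open>\<phi>\<close> is needed for the limit to pass through it; elsewhere the slopes may
  converge to a wrong value or not at all.\<close>

lemma euler_limit_eq_integral:
  assumes "0 \<le> t" and cont: "AE s in lborel. 0 \<le> s \<longrightarrow> isCont \<phi> (f s + euler_limit f s)"
  shows "euler_limit f t = - (LBINT s:{0..t}. \<phi> (f s + euler_limit f s))"
proof -
  have "(\<lambda>n. LBINT s:{0..t}. euler_slope f (step n) s) \<longlonglongrightarrow> (LBINT s:{0..t}. \<phi> (f s + euler_limit f s))"
    unfolding set_lebesgue_integral_def
  proof (rule integral_dominated_convergence[where w = "\<lambda>s. \<Delta> * indicat_real {0..t} s"])
    show "AE s in lborel. (\<lambda>n. indicat_real {0..t} s *\<^sub>R euler_slope f (step n) s) \<longlonglongrightarrow>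
        indicat_real {0..t} s *\<^sub>R \<phi> (f s + euler_limit f s)"
      using cont AE_isCont_driver
    proof eventually_elim
      case (elim s)
      show ?case
      proof (cases "s \<in> {0..t}")
        case True
        then have "0 \<le> s" by simp
        \<comment> \<open>Convergence is known at fixed times whereas \<open>grid n s\<close> moves
          with \<open>n\<close>; the Lipschitz bound uniform in \<open>n\<close> bridges the
          two.\<close>
        have "(\<lambda>n. euler_path f (step n) (grid n s) - euler_path f (step n) s) \<longlonglongrightarrow> 0"
        proof (rule Lim_null_comparison)
          have "(\<lambda>n. \<Delta> * step n) \<longlonglongrightarrow> \<Delta> * 0"
            by (intro tendsto_mult tendsto_const step_tendsto)
          then show "(\<lambda>n. \<Delta> * step n) \<longlonglongrightarrow> 0" by simp
          have "norm (euler_path f (step n) (grid n s) - euler_path f (step n) s) \<le> \<Delta> * step n" for n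
          proof -
            have "grid n s \<le> s" "s - grid n s \<le> step n" "0 \<le> grid n s"
              using grid_bounds[of "step n" s] \<open>0 \<le> s\<close> by auto
            moreover from this have "\<Delta> * (s - grid n s) \<le> \<Delta> * step n"
              using bound_nonneg by (intro mult_left_mono)
            ultimately show ?thesis
              using euler_path_diff[of "step n" "grid n s" s f] by auto
          qed
          then show "\<forall>\<^sub>F n in sequentially. norm (euler_path f (step n) (grid n s) - euler_path f (step n) s) \<le> \<Delta> * step n"
            by simp
        qed
        then have "(\<lambda>n. euler_path f (step n) (grid n s) - euler_path f (step n) s + euler_path f (step n) s)
            \<longlonglongrightarrow> 0 + euler_limit f s"
          by (intro tendsto_add euler_path_convergent \<open>0 \<le> s\<close>)
        moreover have "(\<lambda>n. f (grid n s)) \<longlonglongrightarrow> f s"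
          using elim(2) grid_tendsto[OF \<open>0 \<le> s\<close>] by (rule isCont_tendsto_compose)
        ultimately have "(\<lambda>n. f (grid n s) + euler_path f (step n) (grid n s)) \<longlonglongrightarrow> f s + euler_limit f s"
          using tendsto_add by fastforce
        then have "(\<lambda>n. euler_slope f (step n) s) \<longlonglongrightarrow> \<phi> (f s + euler_limit f s)"
          using elim(1) \<open>0 \<le> s\<close> by (auto simp: euler_slope_eq intro: isCont_tendsto_compose)
        then show ?thesis
          by (intro tendsto_intros)
      qed simp
    qed
    show "(\<lambda>s. indicat_real {0..t} s *\<^sub>R \<phi> (f s + euler_limit f s)) \<in> borel_measurable lborel"
      using borel_measurable_indicator_solution[OF borel_measurable_phi] by simp
    show "integrable lborel (\<lambda>s. \<Delta> * indicat_real {0..t} s)"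
      using assms(1) by (intro integrable_mult_right integrable_real_indicator) auto
  qed (auto simp: indicator_def euler_slope_def Let_def nonneg le_bound)
  then have "(\<lambda>n. - (LBINT s:{0..t}. euler_slope f (step n) s)) \<longlonglongrightarrow> - (LBINT s:{0..t}. \<phi> (f s + euler_limit f s))"
    by (rule tendsto_minus)
  then have "(\<lambda>n. euler_path f (step n) t) \<longlonglongrightarrow> - (LBINT s:{0..t}. \<phi> (f s + euler_limit f s))"
    using assms(1) by (simp add: euler_path_eq_integral)
  then show ?thesis
    using euler_path_convergent[OF assms(1)] LIMSEQ_unique by blast
qed

end

end

section \<open>The Laplace exponent\<close>

text \<open>Equivalent to \<open>1 \<le> (1 - x + x\<^sup>2) * exp x\<close>, which follows from
  \<open>exp x \<ge> 1 + x\<close> because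
  \<open>(1 - x + x\<^sup>2) * (1 + x) = 1 + x ^ 3\<close>.\<close>

lemma exp_minus_le_quadratic:
  fixes x :: real
  assumes "0 \<le> x"
  shows "exp (- x) - 1 + x \<le> x\<^sup>2"
proof -
  have "(1 - x + x\<^sup>2) * (1 + x) = 1 + x ^ 3"
    by (simp add: algebra_simps power2_eq_square power3_eq_cube)
  then have "1 \<le> (1 - x + x\<^sup>2) * (1 + x)"
    using assms by simp
  also have "\<dots> \<le> (1 - x + x\<^sup>2) * exp x"
  proof (rule mult_left_mono)
    have "0 \<le> (1 - x / 2)\<^sup>2 + 3 / 4 * x\<^sup>2" by simp
    also have "\<dots> = 1 - x + x\<^sup>2" by (simp add: power2_eq_square algebra_simps)
    finally show "0 \<le> 1 - x + x\<^sup>2" .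
  qed (rule exp_ge_add_one_self)
  finally show ?thesis
    by (simp add: exp_minus field_simps)
qed

text \<open>With \<open>w = 1 - exp (- x)\<close> the left side is
  \<open>w\<^sup>2 + 2 * (x - w)\<close> and the right side \<open>6 * (x - w)\<close>, so the claim
  is \<open>w\<^sup>2 \<le> 4 * (x - w)\<close>. For \<open>x \<le> 2\<close> this comes from
  squaring \<open>1 - x / 2 \<le> exp (- x / 2)\<close>; for larger \<open>x\<close> the right side
  exceeds 4 while \<open>w \<le> 1\<close>.\<close>

lemma exp_minus_double_le:
  fixes x :: real
  assumes "0 \<le> x"
  shows "exp (- (2 * x)) - 1 + 2 * x \<le> 6 * (exp (- x) - 1 + x)"
proof -
  define w where "w = 1 - exp (- x)"
  have w: "0 \<le> w" "w \<le> 1" "w \<le> x"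
    using assms exp_ge_add_one_self[of "- x"] by (auto simp: w_def)
  have "w\<^sup>2 \<le> 4 * (x - w)"
  proof (cases "x \<le> 2")
    case True
    have "(1 - x / 2)\<^sup>2 \<le> (exp (- x / 2))\<^sup>2"
      using True exp_ge_add_one_self[of "- x / 2"] by (intro power_mono) auto
    also have "(exp (- x / 2))\<^sup>2 = 1 - w"
      by (simp add: w_def power2_eq_square exp_add[symmetric])
    finally have "x\<^sup>2 \<le> 4 * (x - w)"
      by (simp add: power2_eq_square algebra_simps)
    moreover have "w\<^sup>2 \<le> x\<^sup>2"
      using w by (intro power_mono) auto
    ultimately show ?thesis by simp
  next
    case False
    have "w\<^sup>2 \<le> 1" using w by (simp add: power_le_one)
    with False w show ?thesis by simp
  qed
  moreover have "exp (- (2 * x)) = (1 - w)\<^sup>2"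
    by (simp add: w_def power2_eq_square exp_add[symmetric])
  ultimately show ?thesis
    by (simp add: w_def power2_eq_square algebra_simps)
qed

section \<open>Growth and doubling of the Laplace exponent\<close>

context spectrally_negative_levy_process
begin

abbreviation \<psi> :: "real \<Rightarrow> real" where
  "\<psi> \<equiv> laplace_exponent \<gamma> \<sigma> \<nu>"

definition small_jumps :: "real \<Rightarrow> real" where
  "small_jumps l = (LINT z:{0<..<1}|\<nu>. exp (- (l * z)) - 1 + l * z)"

definition large_jump_mass :: real where
  "large_jump_mass = (LINT z:{1..}|\<nu>. 1)"

declare sets_nu [measurable_cong]

lemma borel_measurable_nu: "f \<in> borel_measurable borel \<Longrightarrow> f \<in> borel_measurable \<nu>"
  using measurable_cong_sets[OF sets_nu refl] by blast

lemma integrable_min_square: "integrable \<nu> (\<lambda>z. min 1 (z\<^sup>2))"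
  using nu_integrable by (intro integrableI_nonneg borel_measurable_nu) auto

lemma set_integrable_nu:
  assumes [measurable]: "g \<in> borel_measurable borel" "A \<in> sets borel"
    and "\<And>z. z \<in> A \<Longrightarrow> \<bar>g z\<bar> \<le> C * min 1 (z\<^sup>2)"
  shows "set_integrable \<nu> A g"
  unfolding set_integrable_def
proof (rule Bochner_Integration.integrable_bound)
  show "integrable \<nu> (\<lambda>z. C * min 1 (z\<^sup>2))"
    using integrable_min_square by simp
  show "(\<lambda>z. indicat_real A z *\<^sub>R g z) \<in> borel_measurable \<nu>"
    by (intro borel_measurable_nu) measurable
  show "AE z in \<nu>. norm (indicat_real A z *\<^sub>R g z) \<le> norm (C * min 1 (z\<^sup>2))"
    using assms(3) by (intro AE_I2) (auto simp: indicator_def intro: order_trans[OF _ abs_ge_self])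
qed

lemma set_integrable_small_jumps:
  assumes "0 \<le> l"
  shows "set_integrable \<nu> {0<..<1} (\<lambda>z. exp (- (l * z)) - 1 + l * z)"
proof (rule set_integrable_nu[where C = "l\<^sup>2"])
  fix z :: real assume z: "z \<in> {0<..<1}"
  then have "z\<^sup>2 \<le> 1" by (simp add: power_le_one)
  moreover have "exp (- (l * z)) - 1 + l * z \<le> (l * z)\<^sup>2"
    using assms z by (intro exp_minus_le_quadratic) auto
  moreover have "0 \<le> exp (- (l * z)) - 1 + l * z"
    using exp_ge_add_one_self[of "- (l * z)"] by simp
  ultimately show "\<bar>exp (- (l * z)) - 1 + l * z\<bar> \<le> l\<^sup>2 * min 1 (z\<^sup>2)"
    by (simp add: power_mult_distrib)
qed auto

lemma set_integrable_large_jumps: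
  assumes "0 \<le> l"
  shows "set_integrable \<nu> {1..} (\<lambda>z. exp (- (l * z)) - 1)" "set_integrable \<nu> {1..} (\<lambda>z. 1 :: real)"
  using assms by (auto intro!: set_integrable_nu[where C = 1])

lemma small_jumps_nonneg: "0 \<le> small_jumps l"
proof -
  have "0 \<le> exp (- (l * z)) - 1 + l * z" for z
    using exp_ge_add_one_self[of "- (l * z)"] by simp
  then show ?thesis
    unfolding small_jumps_def set_lebesgue_integral_def by (intro integral_nonneg_AE AE_I2) simp
qed

lemma large_jump_mass_nonneg: "0 \<le> large_jump_mass"
  unfolding large_jump_mass_def set_lebesgue_integral_def by (intro integral_nonneg_AE AE_I2) simp

text \<open>Jumps of size at least 1 are not compensated, and their integrand
  \<open>exp (- (l * z)) - 1\<close> lies in \<open>[-1, 0]\<close>: they cost at most a constant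
  independent of \<open>l\<close>.\<close>

lemma laplace_exponent_bounds:
  assumes "0 \<le> l"
  shows "\<gamma> * l + \<sigma>\<^sup>2 * l\<^sup>2 / 2 + small_jumps l - large_jump_mass \<le> \<psi> l"
    and "\<psi> l \<le> \<gamma> * l + \<sigma>\<^sup>2 * l\<^sup>2 / 2 + small_jumps l"
proof -
  let ?g = "\<lambda>z. exp (- l * z) - 1 + l * z * indicator {0<..<1} z"
  let ?J = "LINT z:{1..}|\<nu>. exp (- (l * z)) - 1"
  have split: "{0<..} = {0<..<1} \<union> {1::real..}" by auto
  have "(LINT z:{0<..<1} \<union> {1..}|\<nu>. ?g z) = (LINT z:{0<..<1}|\<nu>. ?g z) + (LINT z:{1..}|\<nu>. ?g z)"
  proof (rule set_integral_Un)
    show "set_integrable \<nu> {0<..<1} ?g"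
      using set_integrable_small_jumps[OF assms]
      by (rule set_integrable_cong[THEN iffD1, rotated -1]) (auto simp: sets_nu)
    show "set_integrable \<nu> {1..} ?g"
      using set_integrable_large_jumps(1)[OF assms]
      by (rule set_integrable_cong[THEN iffD1, rotated -1]) (auto simp: sets_nu)
  qed auto
  also have "(LINT z:{0<..<1}|\<nu>. ?g z) = small_jumps l"
    unfolding small_jumps_def by (intro set_lebesgue_integral_cong) (auto simp: sets_nu)
  also have "(LINT z:{1..}|\<nu>. ?g z) = ?J"
    by (intro set_lebesgue_integral_cong) (auto simp: sets_nu)
  finally have eq: "\<psi> l = \<gamma> * l + \<sigma>\<^sup>2 * l\<^sup>2 / 2 + small_jumps l + ?J"
    unfolding laplace_exponent_def split by simp
  have "(LINT z:{1..}|\<nu>. -1) \<le> ?J"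
    using set_integrable_large_jumps[OF assms]
    by (intro set_integral_mono) (auto simp: set_integrable_def)
  moreover have "(LINT z:{1..}|\<nu>. -1) = - large_jump_mass"
    unfolding large_jump_mass_def by (simp add: set_lebesgue_integral_def)
  moreover have "?J \<le> (LINT z:{1..}|\<nu>. 0)"
    using set_integrable_large_jumps[OF assms] assms
    by (intro set_integral_mono) (auto simp: set_integrable_def)
  ultimately show "\<gamma> * l + \<sigma>\<^sup>2 * l\<^sup>2 / 2 + small_jumps l - large_jump_mass \<le> \<psi> l"
    "\<psi> l \<le> \<gamma> * l + \<sigma>\<^sup>2 * l\<^sup>2 / 2 + small_jumps l"
    unfolding eq by simp_all
qed

text \<open>Doubling \<open>l\<close> multiplies the Gaussian term by 4 and the small-jump term by
  at most 6. Taking the factor 6 throughout leaves \<open>- 4 * (\<gamma> * l)\<close> from the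
  linear term and 6 times the large-jump mass to be compensated.\<close>

lemma laplace_exponent_double_le:
  assumes "0 \<le> l"
  shows "\<psi> (2 * l) \<le> 6 * \<psi> l + 4 * \<bar>\<gamma>\<bar> * l + 6 * large_jump_mass"
proof -
  have "small_jumps (2 * l) \<le> (LINT z:{0<..<1}|\<nu>. 6 * (exp (- (l * z)) - 1 + l * z))"
    unfolding small_jumps_def
  proof (rule set_integral_mono)
    show "set_integrable \<nu> {0<..<1} (\<lambda>z. exp (- (2 * l * z)) - 1 + 2 * l * z)"
      using assms by (intro set_integrable_small_jumps) simp
    show "set_integrable \<nu> {0<..<1} (\<lambda>z. 6 * (exp (- (l * z)) - 1 + l * z))"
      using set_integrable_small_jumps[OF assms] by (rule set_integrable_mult_right)
    fix z :: real assume "z \<in> {0<..<1}"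
    then show "exp (- (2 * l * z)) - 1 + 2 * l * z \<le> 6 * (exp (- (l * z)) - 1 + l * z)"
      using exp_minus_double_le[of "l * z"] assms by (simp add: mult.assoc)
  qed
  then have I: "small_jumps (2 * l) \<le> 6 * small_jumps l"
    by (simp only: small_jumps_def set_integral_mult_right)
  have "\<psi> (2 * l) \<le> 2 * (\<gamma> * l) + 2 * (\<sigma>\<^sup>2 * l\<^sup>2) + small_jumps (2 * l)"
    using laplace_exponent_bounds(2)[of "2 * l"] assms by (simp add: power_mult_distrib algebra_simps)
  moreover have "6 * (\<gamma> * l) + 3 * (\<sigma>\<^sup>2 * l\<^sup>2) + 6 * small_jumps l - 6 * large_jump_mass \<le> 6 * \<psi> l"
    using laplace_exponent_bounds(1)[OF assms] by simp
  moreover have "- (\<gamma> * l) \<le> \<bar>\<gamma>\<bar> * l"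
    using mult_right_mono[OF abs_ge_minus_self assms, of \<gamma>] by simp
  moreover have "0 \<le> \<sigma>\<^sup>2 * l\<^sup>2" by simp
  ultimately show ?thesis
    using I by linarith
qed

lemma laplace_exponent_le_drift:
  assumes "\<sigma> = 0" "set_integrable \<nu> {0<..<1} (\<lambda>z. z)" "0 \<le> l"
  shows "\<psi> l \<le> levy_drift \<gamma> \<nu> * l"
proof -
  have "small_jumps l \<le> (LINT z:{0<..<1}|\<nu>. l * z)"
    unfolding small_jumps_def using assms
    by (intro set_integral_mono set_integrable_small_jumps) auto
  also have "\<dots> = l * (LINT z:{0<..<1}|\<nu>. z)"
    by simp
  finally show ?thesis
    using laplace_exponent_bounds(2)[OF assms(3)] assms(1) by (simp add: levy_drift_def algebra_simps)
qed

text \<open>Fatou's lemma for \<open>(exp (- (n * z)) - 1 + n * z) / n\<close>, which tends to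
  \<open>z\<close>. Negative \<open>r\<close> is a separate alternative because
  \<open>ennreal r\<close> is then 0, and the strict inequality would fail when there are no small
  jumps.\<close>

lemma small_jumps_growth:
  assumes "r < 0 \<or> ennreal r < (\<integral>\<^sup>+ z. ennreal (indicator {0<..<1} z * z) \<partial>\<nu>)"
  shows "\<forall>\<^sub>F n in sequentially. r * real n \<le> small_jumps (real n)"
proof (cases "r < 0")
  case True
  then have "r * real n \<le> small_jumps (real n)" for n
    using small_jumps_nonneg[of "real n"] by (simp add: mult_nonpos_nonneg order_trans[of _ 0])
  then show ?thesis by simp
next
  case False
  define h where "h n z = indicator {0<..<1} z * (exp (- (real n * z)) - 1 + real n * z) / real n" for n z
  have h_nonneg: "0 \<le> h n z" for n z
    unfolding h_def using exp_ge_add_one_self[of "- (real n * z)"] by (auto simp: indicator_def)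
  have h_int: "(\<integral>\<^sup>+ z. ennreal (h n z) \<partial>\<nu>) = ennreal (small_jumps (real n) / real n)" for n
  proof -
    have "integrable \<nu> (\<lambda>z. h n z)"
      using set_integrable_small_jumps[of "real n"] unfolding h_def set_integrable_def by simp
    then have "(\<integral>\<^sup>+ z. ennreal (h n z) \<partial>\<nu>) = ennreal (\<integral>z. h n z \<partial>\<nu>)"
      using h_nonneg by (intro nn_integral_eq_integral) auto
    then show ?thesis
      by (simp add: h_def small_jumps_def set_lebesgue_integral_def)
  qed
  have lim: "(\<lambda>n. ennreal (h n z)) \<longlonglongrightarrow> ennreal (indicator {0<..<1} z * z)" for z
  proof (cases "z \<in> {0<..<1}")
    case True
    have "(\<lambda>n. z - (1 - exp (- (real n * z))) / real n) \<longlonglongrightarrow> z - 0"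
    proof (intro tendsto_diff tendsto_const Lim_null_comparison[OF _ lim_inverse_n'])
      show "\<forall>\<^sub>F n in sequentially. norm ((1 - exp (- (real n * z))) / real n) \<le> 1 / real n"
        using True by (intro always_eventually allI) (auto simp: divide_right_mono)
    qed
    moreover have "\<forall>\<^sub>F n in sequentially. z - (1 - exp (- (real n * z))) / real n = h n z"
      using eventually_gt_at_top[of "0::nat"]
      by eventually_elim (use True in \<open>simp add: h_def field_simps\<close>)
    ultimately have "(\<lambda>n. h n z) \<longlonglongrightarrow> z"
      using Lim_transform_eventually by fastforce
    then show ?thesis
      using True by (intro tendsto_ennrealI) simp
  qed (simp add: h_def)
  have "ennreal r < (\<integral>\<^sup>+ z. liminf (\<lambda>n. ennreal (h n z)) \<partial>\<nu>)"
    using assms False lim_imp_Liminf[OF sequentially_bot lim] by simp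
  also have "\<dots> \<le> liminf (\<lambda>n. \<integral>\<^sup>+ z. ennreal (h n z) \<partial>\<nu>)"
    by (intro nn_integral_liminf borel_measurable_nu) (simp add: h_def)
  finally have "\<forall>\<^sub>F n in sequentially. ennreal r < ennreal (small_jumps (real n) / real n)"
    unfolding h_int by (rule less_LiminfD)
  then show ?thesis
    using eventually_gt_at_top[of "0::nat"]
  proof eventually_elim
    case (elim n)
    then have "r < small_jumps (real n) / real n"
      using False by (simp add: ennreal_less_iff)
    with elim show ?case
      by (simp add: pos_less_divide_eq)
  qed
qed

text \<open>\<open>\<psi> l / l\<close> tends to infinity or to the drift. The slope
  \<open>\<rho>\<close> is strictly above \<open>a\<close>, a margin that later makes
  \<open>exp (a / \<rho>)\<close> strictly smaller than \<open>e\<close>.\<close>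

lemma laplace_exponent_growth:
  assumes "\<sigma> = 0 \<Longrightarrow> set_integrable \<nu> {0<..<1} (\<lambda>z. z) \<Longrightarrow> a < levy_drift \<gamma> \<nu>"
  obtains \<rho> where "a < \<rho>" "\<forall>\<^sub>F n in sequentially. \<rho> * real n \<le> \<psi> (real n)"
proof -
  have lower: "\<gamma> * real n + \<sigma>\<^sup>2 * (real n)\<^sup>2 / 2 + small_jumps (real n) - large_jump_mass \<le> \<psi> (real n)" for n
    by (rule laplace_exponent_bounds) simp
  have lower_0: "\<gamma> * real n + small_jumps (real n) - large_jump_mass \<le> \<psi> (real n)" for n
    using lower[of n] by (smt (verit) divide_nonneg_nonneg mult_nonneg_nonneg zero_le_power2)
  have mass: "\<forall>\<^sub>F n in sequentially. large_jump_mass \<le> e * real n" if "0 < e" for e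
  proof -
    obtain N where "large_jump_mass / e \<le> real N"
      using real_arch_simple by blast
    then have "large_jump_mass \<le> e * real n" if "n \<ge> N" for n
    proof -
      have "large_jump_mass / e \<le> real n" using \<open>_ \<le> real N\<close> that by linarith
      then show ?thesis using \<open>0 < e\<close> by (simp add: pos_divide_le_eq mult.commute)
    qed
    then show ?thesis by (auto simp: eventually_sequentially)
  qed
  consider (gauss) "\<sigma> \<noteq> 0" | (inf) "\<not> set_integrable \<nu> {0<..<1} (\<lambda>z. z)"
    | (fin) "\<sigma> = 0" "set_integrable \<nu> {0<..<1} (\<lambda>z. z)" by blast
  then show ?thesis
  proof cases
    case gauss
    \<comment> \<open>Of the slope \<open>a + 2 + \<bar>\<gamma>\<bar>\<close>, the part
      \<open>\<bar>\<gamma>\<bar>\<close> absorbs the linear term and one unit the large jumps,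
      leaving \<open>a + 1\<close>. The case of infinite small-jump variation uses the same
      margin.\<close>
    obtain N where N: "2 * (a + 2 + \<bar>\<gamma>\<bar>) / \<sigma>\<^sup>2 \<le> real N"
      using real_arch_simple by blast
    have "\<forall>\<^sub>F n in sequentially. (a + 1) * real n \<le> \<psi> (real n)"
      using mass[of 1, simplified] eventually_ge_at_top[of N]
    proof eventually_elim
      case (elim n)
      have "2 * (a + 2 + \<bar>\<gamma>\<bar>) / \<sigma>\<^sup>2 \<le> real n"
        using N elim(2) by linarith
      then have "a + 2 + \<bar>\<gamma>\<bar> \<le> \<sigma>\<^sup>2 * real n / 2"
        using gauss by (simp add: divide_le_eq mult.commute)
      then have "(a + 2 + \<bar>\<gamma>\<bar>) * real n \<le> \<sigma>\<^sup>2 * real n / 2 * real n"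
        by (rule mult_right_mono) simp
      moreover have "- (\<gamma> * real n) \<le> \<bar>\<gamma>\<bar> * real n"
        using mult_right_mono[OF abs_ge_minus_self, of "real n" \<gamma>] by simp
      ultimately show ?case
        using lower[of n] small_jumps_nonneg[of "real n"] elim(1) by (simp add: power2_eq_square algebra_simps)
    qed
    then show ?thesis by (intro that[of "a + 1"]) auto
  next
    case inf
    have "(\<integral>\<^sup>+ z. ennreal (indicator {0<..<1} z * z) \<partial>\<nu>) = \<infinity>"
    proof (rule ccontr)
      assume "\<not> ?thesis"
      then have "integrable \<nu> (\<lambda>z. indicator {0<..<1} z * z :: real)"
        by (intro integrableI_nonneg borel_measurable_nu) (auto simp: top.not_eq_extremum indicator_def)
      with inf show False by (simp add: set_integrable_def)
    qed
    then have "\<forall>\<^sub>F n in sequentially. (a + 2 + \<bar>\<gamma>\<bar>) * real n \<le> small_jumps (real n)"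
      by (intro small_jumps_growth) (simp add: less_top[symmetric])
    then have "\<forall>\<^sub>F n in sequentially. (a + 1) * real n \<le> \<psi> (real n)"
      using mass[of 1, simplified]
    proof eventually_elim
      case (elim n)
      moreover have "- (\<gamma> * real n) \<le> \<bar>\<gamma>\<bar> * real n"
        using mult_right_mono[OF abs_ge_minus_self, of "real n" \<gamma>] by simp
      ultimately show ?case
        using lower_0[of n] by (simp add: algebra_simps)
    qed
    then show ?thesis by (intro that[of "a + 1"]) auto
  next
    case fin
    define c where "c = (LINT z:{0<..<1}|\<nu>. z)"
    \<comment> \<open>A third of the gap between the drift and \<open>a\<close> is lost in Fatou's
      lemma and a third to the large jumps; the last third remains.\<close>
    define e where "e = (\<gamma> + c - a) / 3"
    have e: "0 < e" "a + e = \<gamma> + c - 2 * e"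
      using assms[OF fin] by (simp_all add: e_def c_def levy_drift_def field_simps)
    have "(\<integral>\<^sup>+ z. ennreal (indicator {0<..<1} z * z) \<partial>\<nu>) = ennreal c"
      using fin(2) unfolding c_def set_integrable_def set_lebesgue_integral_def
      by (subst nn_integral_eq_integral) (auto simp: indicator_def)
    then have "\<forall>\<^sub>F n in sequentially. (c - e) * real n \<le> small_jumps (real n)"
      using e(1) by (intro small_jumps_growth) (cases "c < e"; simp add: ennreal_less_iff)
    then have "\<forall>\<^sub>F n in sequentially. (a + e) * real n \<le> \<psi> (real n)"
      using mass[OF e(1)]
    proof eventually_elim
      case (elim n)
      then show ?case
        using lower_0[of n] unfolding e(2) by (simp add: algebra_simps)
    qed
    then show ?thesis using e(1) by (intro that[of "a + e"]) auto
  qed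
qed

end

section \<open>Increments of the process\<close>

context levy_process
begin

lemma borel_measurable_X: "0 \<le> t \<Longrightarrow> X t \<in> borel_measurable M"
  using adapted subalgebra_F by (blast intro: measurable_from_subalg)

lemma borel_measurable_increment: "0 \<le> s \<Longrightarrow> 0 \<le> t \<Longrightarrow> (\<lambda>\<omega>. X t \<omega> - X s \<omega>) \<in> borel_measurable M"
  by (intro borel_measurable_diff borel_measurable_X)

lemma prob_increment:
  assumes "0 \<le> s" "s \<le> t" "A \<in> sets borel"
  shows "prob {\<omega>\<in>space M. X t \<omega> - X s \<omega> \<in> A} = prob {\<omega>\<in>space M. X (t - s) \<omega> - X 0 \<omega> \<in> A}"
proof -
  have "measure (distr M borel (\<lambda>\<omega>. X t \<omega> - X s \<omega>)) A = measure (distr M borel (\<lambda>\<omega>. X (t - s) \<omega> - X 0 \<omega>)) A"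
    by (simp only: stationary_increments[OF assms(1,2)])
  then show ?thesis
    using assms by (simp add: measure_distr borel_measurable_increment vimage_def Int_def conj_commute)
qed

lemma prob_indep_increment:
  assumes "0 \<le> s" "s \<le> t" "A \<in> sets (F s)" "B \<in> sets borel"
  shows "prob {\<omega>\<in>space M. \<omega> \<in> A \<and> X t \<omega> - X s \<omega> \<in> B} =
    prob A * prob {\<omega>\<in>space M. X (t - s) \<omega> - X 0 \<omega> \<in> B}"
proof -
  have "(\<lambda>\<omega>. X t \<omega> - X s \<omega>) -` B \<inter> space M \<in> sets (vimage_algebra (space M) (\<lambda>\<omega>. X t \<omega> - X s \<omega>) borel)"
    using assms(4) by (rule in_vimage_algebra)
  then have "prob (A \<inter> ((\<lambda>\<omega>. X t \<omega> - X s \<omega>) -` B \<inter> space M)) = prob A * prob ((\<lambda>\<omega>. X t \<omega> - X s \<omega>) -` B \<inter> space M)"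
    using assms(3) indep_setD[OF indep_increments[OF assms(1,2)]] by blast
  moreover have "A \<inter> ((\<lambda>\<omega>. X t \<omega> - X s \<omega>) -` B \<inter> space M) = {\<omega>\<in>space M. \<omega> \<in> A \<and> X t \<omega> - X s \<omega> \<in> B}"
    by auto
  moreover have "(\<lambda>\<omega>. X t \<omega> - X s \<omega>) -` B \<inter> space M = {\<omega>\<in>space M. X t \<omega> - X s \<omega> \<in> B}"
    by auto
  ultimately show ?thesis
    using prob_increment[OF assms(1,2,4)] by simp
qed

end

text \<open>Chernoff's bound with exponent \<open>n\<close> gives probability at most
  \<open>exp (- e) ^ n\<close> for \<open>Y\<close> to reach \<open>a + e\<close>; let
  \<open>n\<close> tend to infinity.\<close>

lemma (in prob_space) AE_le_of_exp_moments:
  fixes Y :: "'a \<Rightarrow> real"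
  assumes "\<And>l. 0 \<le> l \<Longrightarrow> integrable M (\<lambda>\<omega>. exp (l * Y \<omega>))"
    and "\<And>l. 0 \<le> l \<Longrightarrow> expectation (\<lambda>\<omega>. exp (l * Y \<omega>)) \<le> exp (l * a)"
    and [measurable]: "Y \<in> borel_measurable M"
  shows "AE \<omega> in M. Y \<omega> \<le> a"
proof -
  have null: "prob {\<omega>\<in>space M. a + e \<le> Y \<omega>} = 0" if e: "0 < e" for e :: real
  proof (rule LIMSEQ_le_const[of "\<lambda>n. exp (- e) ^ n", THEN antisym])
    show "(\<lambda>n. exp (- e) ^ n) \<longlonglongrightarrow> 0"
      using e by (intro LIMSEQ_power_zero) simp
    have "prob {\<omega>\<in>space M. a + e \<le> Y \<omega>} \<le> exp (- e) ^ n" for n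
    proof -
      have "prob {\<omega>\<in>space M. a + e \<le> Y \<omega>}
          \<le> prob {\<omega>\<in>space M. exp (real n * (a + e)) \<le> exp (real n * Y \<omega>)}"
        by (intro finite_measure_mono) (auto intro!: mult_left_mono)
      also have "\<dots> \<le> expectation (\<lambda>\<omega>. exp (real n * Y \<omega>)) / exp (real n * (a + e))"
        using assms(1)[of "real n"] by (intro integral_Markov_inequality_measure[where A = "{}"]) auto
      also have "\<dots> \<le> exp (real n * a) / exp (real n * (a + e))"
        by (intro divide_right_mono assms(2)) auto
      also have "\<dots> = exp (- e) ^ n"
        by (simp add: exp_of_nat_mult[symmetric] exp_diff[symmetric] algebra_simps)
      finally show ?thesis .
    qed
    then show "\<exists>N. \<forall>n\<ge>N. prob {\<omega>\<in>space M. a + e \<le> Y \<omega>} \<le> exp (- e) ^ n"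
      by blast
  qed simp
  have "AE \<omega> in M. \<forall>k. Y \<omega> < a + 1 / real (Suc k)"
    unfolding AE_all_countable
  proof
    fix k
    have "prob {\<omega>\<in>space M. \<not> (Y \<omega> < a + 1 / real (Suc k))} = 0"
      using null[of "1 / real (Suc k)"] by (simp add: not_less)
    then show "AE \<omega> in M. Y \<omega> < a + 1 / real (Suc k)"
      by (subst AE_iff_measurable[OF _ refl]) (auto simp: emeasure_eq_measure)
  qed
  then show ?thesis
  proof eventually_elim
    case (elim \<omega>)
    show ?case
    proof (rule ccontr)
      assume "\<not> Y \<omega> \<le> a"
      then obtain k where "1 / real (Suc k) < Y \<omega> - a"
        using nat_approx_posE[of "Y \<omega> - a"] by auto
      with elim[rule_format, of k] show False by simp
    qed
  qed
qed

text \<open>\<open>c * t - f t\<close> is nondecreasing, so \<open>f\<close> is a difference of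
  monotone functions. The terms with \<open>\<bar>c\<bar>\<close> cover either sign of
  \<open>c\<close>, and the bounding sum telescopes.\<close>

lemma locally_bounded_variation_if_increments_le:
  assumes "\<And>s t. 0 \<le> s \<Longrightarrow> s \<le> t \<Longrightarrow> f t - f s \<le> c * (t - s)"
  shows "locally_bounded_variation f"
  unfolding locally_bounded_variation_def
proof (intro allI impI)
  fix T :: real assume "0 \<le> T"
  define g where "g t = \<bar>c\<bar> * t + (c * t - f t)" for t
  show "\<exists>B. \<forall>n t. mono_on {..n} t \<and> t ` {..n} \<subseteq> {0..T} \<longrightarrow> (\<Sum>i<n. \<bar>f (t (Suc i)) - f (t i)\<bar>) \<le> B"
  proof (intro exI allI impI)
    fix n and t :: "nat \<Rightarrow> real" assume t: "mono_on {..n} t \<and> t ` {..n} \<subseteq> {0..T}"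
    have g_mono: "g s \<le> g r" if "0 \<le> s" "s \<le> r" for s r
    proof -
      have "0 \<le> \<bar>c\<bar> * (r - s)" using that by simp
      then show ?thesis using assms[OF that] by (simp add: g_def algebra_simps)
    qed
    have "(\<Sum>i<n. \<bar>f (t (Suc i)) - f (t i)\<bar>) \<le> (\<Sum>i<n. g (t (Suc i)) - g (t i) + \<bar>c\<bar> * (t (Suc i) - t i))"
    proof (rule sum_mono)
      fix i assume "i \<in> {..<n}"
      then have le: "0 \<le> t i" "t i \<le> t (Suc i)"
        using t by (auto simp: mono_on_def image_subset_iff)
      have "\<bar>c * (t (Suc i) - t i)\<bar> = \<bar>c\<bar> * (t (Suc i) - t i)"
        using le by (simp add: abs_mult)
      then show "\<bar>f (t (Suc i)) - f (t i)\<bar> \<le> g (t (Suc i)) - g (t i) + \<bar>c\<bar> * (t (Suc i) - t i)"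
        using assms[OF le] unfolding g_def right_diff_distrib by linarith
    qed
    also have "\<dots> = g (t n) - g (t 0) + \<bar>c\<bar> * (t n - t 0)"
      by (simp only: sum.distrib sum_distrib_left[symmetric] sum_lessThan_telescope
          sum_lessThan_telescope[of "\<lambda>i. g (t i)"])
    also have "\<dots> \<le> g T - g 0 + \<bar>c\<bar> * T"
    proof -
      have "0 \<le> t 0" "0 \<le> t n" "t n \<le> T"
        using t by (auto simp: image_subset_iff)
      moreover from this have "\<bar>c\<bar> * (t n - t 0) \<le> \<bar>c\<bar> * T"
        by (intro mult_left_mono) auto
      ultimately show ?thesis
        using g_mono[of "t n" T] g_mono[of 0 "t 0"] by simp
    qed
    finally show "(\<Sum>i<n. \<bar>f (t (Suc i)) - f (t i)\<bar>) \<le> g T - g 0 + \<bar>c\<bar> * T" .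
  qed
qed

text \<open>By right continuity, a violation at \<open>s\<close> and \<open>t\<close> persists at
  rationals slightly to the right of both; taking the first one below \<open>t\<close> keeps them in
  order.\<close>

lemma increments_le_of_rational_increments_le:
  fixes f :: "real \<Rightarrow> real"
  assumes cont: "\<And>t. 0 \<le> t \<Longrightarrow> continuous (at_right t) f"
    and rat: "\<And>p q. p \<in> \<rat> \<Longrightarrow> q \<in> \<rat> \<Longrightarrow> 0 \<le> p \<Longrightarrow> p \<le> q \<Longrightarrow> f q - f p \<le> c * (q - p)"
    and st: "0 \<le> s" "s \<le> t"
  shows "f t - f s \<le> c * (t - s)"
proof (rule ccontr)
  define g where "g u = c * u - f u" for u
  assume neg: "\<not> ?thesis"
  with st have "s < t" by (cases "s = t") auto
  define e where "e = g s - g t"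
  have "0 < e"
    using neg by (simp add: e_def g_def algebra_simps)
  have lim: "(g \<longlongrightarrow> g u) (at_right u)" if "0 \<le> u" for u
    using cont[OF that] unfolding g_def continuous_within by (intro tendsto_intros)
  have "\<forall>\<^sub>F u in at_right s. g s - e / 2 < g u"
    using lim[of s] st \<open>0 < e\<close> by (intro order_tendstoD) auto
  then obtain d1 where d1: "s < d1" "\<And>u. s < u \<Longrightarrow> u < d1 \<Longrightarrow> g s - e / 2 < g u"
    by (auto simp: eventually_at_right_field)
  have "\<forall>\<^sub>F u in at_right t. g u < g t + e / 2"
    using lim[of t] st \<open>0 < e\<close> by (intro order_tendstoD) auto
  then obtain d2 where d2: "t < d2" "\<And>u. t < u \<Longrightarrow> u < d2 \<Longrightarrow> g u < g t + e / 2"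
    by (auto simp: eventually_at_right_field)
  obtain p where p: "p \<in> \<rat>" "s < p" "p < min t d1"
    using Rats_dense_in_real[of s "min t d1"] \<open>s < t\<close> d1(1) by auto
  obtain q where q: "q \<in> \<rat>" "t < q" "q < d2"
    using Rats_dense_in_real[OF d2(1)] by auto
  have "g p \<le> g q"
    using rat[OF p(1) q(1)] p q st by (simp add: g_def algebra_simps)
  then show False
    using d1(2)[of p] d2(2)[of q] p q unfolding e_def by (simp add: field_simps)
qed

section \<open>From exponential moments to path variation and short-time increments\<close>

context spectrally_negative_levy_process
begin

text \<open>\<open>\<psi> l \<le> c * l\<close> for all \<open>l\<close>, with \<open>c\<close> the
  drift, is exactly the moment bound that Chernoff's argument needs. Stationarity then moves the
  bound, as a property of the law, from the start to time \<open>s\<close>.\<close>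

lemma AE_increment_le:
  assumes "\<sigma> = 0" "set_integrable \<nu> {0<..<1} (\<lambda>z. z)" "0 \<le> s" "s \<le> t"
  shows "AE \<omega> in M. X t \<omega> - X s \<omega> \<le> levy_drift \<gamma> \<nu> * (t - s)"
proof -
  define r where "r = t - s"
  define c where "c = levy_drift \<gamma> \<nu>"
  have "0 \<le> r" using assms by (simp add: r_def)
  have "AE \<omega> in M. X r \<omega> - x \<le> c * r"
  proof (rule AE_le_of_exp_moments)
    fix l :: real assume l: "0 \<le> l"
    show "integrable M (\<lambda>\<omega>. exp (l * (X r \<omega> - x)))"
      using laplace[OF l \<open>0 \<le> r\<close>] by (rule has_bochner_integral_iff[THEN iffD1, THEN conjunct1])
    have "r * \<psi> l \<le> r * (c * l)"
      unfolding c_def using laplace_exponent_le_drift[OF assms(1,2) l] \<open>0 \<le> r\<close> by (rule mult_left_mono)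
    then show "expectation (\<lambda>\<omega>. exp (l * (X r \<omega> - x))) \<le> exp (l * (c * r))"
      using has_bochner_integral_integral_eq[OF laplace[OF l \<open>0 \<le> r\<close>]] by (simp add: mult_ac)
  qed (use borel_measurable_X[OF \<open>0 \<le> r\<close>] in measurable)
  then have "AE \<omega> in M. X r \<omega> - X 0 \<omega> \<le> c * r"
    using start by eventually_elim simp
  then have "AE y in distr M borel (\<lambda>\<omega>. X r \<omega> - X 0 \<omega>). y \<le> c * r"
    using \<open>0 \<le> r\<close> by (subst AE_distr_iff) (auto intro!: borel_measurable_increment)
  then have "AE y in distr M borel (\<lambda>\<omega>. X t \<omega> - X s \<omega>). y \<le> c * r"
    unfolding stationary_increments[OF assms(3,4)] r_def .
  then show ?thesis
    unfolding r_def c_def by (rule AE_distrD[rotated]) (use assms in \<open>auto intro!: borel_measurable_increment\<close>)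
qed

text \<open>Links the two descriptions of the case distinction: the drift assumption speaks of the
  paths, the growth of \<open>\<psi>\<close> of \<open>\<sigma>\<close> and
  \<open>\<nu>\<close>.\<close>

lemma bounded_variation_paths_if_finite_small_jumps:
  assumes "\<sigma> = 0" "set_integrable \<nu> {0<..<1} (\<lambda>z. z)"
  shows "bounded_variation_paths M X"
proof -
  define c where "c = levy_drift \<gamma> \<nu>"
  have "AE \<omega> in M. \<forall>p\<in>\<rat>. \<forall>q\<in>\<rat>. 0 \<le> p \<longrightarrow> p \<le> q \<longrightarrow> X q \<omega> - X p \<omega> \<le> c * (q - p)"
    unfolding c_def using AE_increment_le[OF assms]
    by (intro AE_ball_countable' countable_rat) auto
  then show ?thesis
    unfolding bounded_variation_paths_def using cadlag_paths
  proof eventually_elim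
    case (elim \<omega>)
    have "X t \<omega> - X s \<omega> \<le> c * (t - s)" if "0 \<le> s" "s \<le> t" for s t
    proof (rule increments_le_of_rational_increments_le[OF _ _ that])
      show "continuous (at_right r) (\<lambda>t. X t \<omega>)" if "0 \<le> r" for r
        using elim(2) that by (simp add: cadlag_def)
      show "X q \<omega> - X p \<omega> \<le> c * (q - p)" if "p \<in> \<rat>" "q \<in> \<rat>" "0 \<le> p" "p \<le> q" for p q
        using elim(1) that by blast
    qed
    then show ?case
      by (rule locally_bounded_variation_if_increments_le)
  qed
qed

text \<open>If the increments over short times \<open>u\<close> were concentrated on \<open>[0, \<Delta> u]\<close>, then
  \<open>E exp (n (X u - x)) = e\<close>, with \<open>u = 1 / \<psi> n\<close>, would be at most \<open>exp (n \<Delta> u) < e\<close> up to a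
  small error, as \<open>\<psi> n / n\<close> stays above \<open>\<Delta>\<close>.\<close>

lemma prob_slow_increment_bounded_away_from_1:
  assumes drift: "bounded_variation_paths M X \<Longrightarrow> \<Delta> < levy_drift \<gamma> \<nu>" and "0 < \<Delta>"
  obtains u q where "\<And>n. 0 < u n" "u \<longlonglongrightarrow> (0 :: real)" "q < 1"
    "\<forall>\<^sub>F n in sequentially. prob {\<omega>\<in>space M. X (u n) \<omega> - X 0 \<omega> \<in> {0..\<Delta> * u n}} \<le> q"
proof -
  obtain \<rho> where \<rho>: "\<Delta> < \<rho>" "\<forall>\<^sub>F n in sequentially. \<rho> * real n \<le> \<psi> (real n)"
    using laplace_exponent_growth[of \<Delta>] drift bounded_variation_paths_if_finite_small_jumps by blast
  have "0 < \<rho>" using \<rho>(1) \<open>0 < \<Delta>\<close> by simp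
  \<comment> \<open>The second branch, left behind for large \<open>n\<close>, only keeps
    \<open>u n\<close> positive for every \<open>n\<close>.\<close>
  define u where "u n = (if 0 < \<psi> (real n) then 1 / \<psi> (real n) else 1 / real (Suc n))" for n
  define a where "a = \<Delta> / \<rho>"
  have "a < 1" using \<rho> \<open>0 < \<rho>\<close> by (simp add: a_def)
  \<comment> \<open>Bounds the second moment: multiply the doubling inequality by
    \<open>u n = 1 / \<psi> n\<close> and use that \<open>n / \<psi> n\<close> and
    \<open>1 / \<psi> n\<close> are at most \<open>1 / \<rho>\<close>.\<close>
  define C where "C = exp (6 + 4 * \<bar>\<gamma>\<bar> / \<rho> + 6 * large_jump_mass / \<rho>)"
  define gap where "gap = exp 1 - exp a"
  have "0 < gap" using \<open>a < 1\<close> by (simp add: gap_def)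
  \<comment> \<open>Weight of the AM-GM inequality below, chosen so that the second-moment term
    \<open>r / 2 * C\<close> uses up half of \<open>gap\<close>. The resulting \<open>q\<close> is
    \<open>1 - r * gap\<close>.\<close>
  define r where "r = gap / C"
  have "0 < C" "0 < r" using \<open>0 < gap\<close> by (auto simp: C_def r_def)
  have eventually_pos: "\<forall>\<^sub>F n in sequentially. 1 \<le> n \<and> \<rho> * real n \<le> \<psi> (real n)"
    using \<rho>(2) eventually_ge_at_top[of "1::nat"] by eventually_elim simp
  have "\<forall>\<^sub>F n in sequentially. u n \<le> 1 / \<rho> * (1 / real n)"
    using eventually_pos
  proof eventually_elim
    case (elim n)
    then have "0 < \<rho> * real n" using \<open>0 < \<rho>\<close> by simp
    then have "0 < \<psi> (real n)" "1 / \<psi> (real n) \<le> 1 / (\<rho> * real n)"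
      using elim by (auto intro!: divide_left_mono mult_pos_pos)
    then show ?case by (simp add: u_def)
  qed
  moreover have "(\<lambda>n. 1 / \<rho> * (1 / real n)) \<longlonglongrightarrow> 1 / \<rho> * 0"
    by (intro tendsto_mult tendsto_const lim_inverse_n')
  ultimately have u_tendsto: "u \<longlonglongrightarrow> 0"
    by (intro real_tendsto_sandwich[of "\<lambda>_. 0" u _ "\<lambda>n. 1 / \<rho> * (1 / real n)"])
      (auto intro!: always_eventually simp: u_def)
  have "\<forall>\<^sub>F n in sequentially. prob {\<omega>\<in>space M. X (u n) \<omega> - X 0 \<omega> \<in> {0..\<Delta> * u n}} \<le> 1 - r * gap"
    using eventually_pos
  proof eventually_elim
    case (elim n)
    have \<psi>: "0 < \<rho> * real n" "0 < \<psi> (real n)"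
      using elim \<open>0 < \<rho>\<close> by (auto intro: less_le_trans[of 0 "\<rho> * real n"])
    then have u: "u n = 1 / \<psi> (real n)" "0 \<le> u n" by (auto simp: u_def)
    define Y where "Y \<omega> = exp (real n * (X (u n) \<omega> - x))" for \<omega>
    define good where "good = {\<omega>\<in>space M. X (u n) \<omega> - X 0 \<omega> \<in> {0..\<Delta> * u n}}"
    have good [measurable]: "good \<in> sets M"
      using borel_measurable_increment[of 0 "u n"] u unfolding good_def by measurable
    have Y: "integrable M Y" "expectation Y = exp 1"
      using laplace[of "real n" "u n"] \<psi> u by (simp_all add: has_bochner_integral_iff Y_def[abs_def])
    have "(Y \<omega>)\<^sup>2 = exp (2 * real n * (X (u n) \<omega> - x))" for \<omega>
      by (simp add: Y_def power2_eq_square exp_add[symmetric])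
    then have Y2: "integrable M (\<lambda>\<omega>. (Y \<omega>)\<^sup>2)" "expectation (\<lambda>\<omega>. (Y \<omega>)\<^sup>2) = exp (u n * \<psi> (2 * real n))"
      using laplace[of "2 * real n" "u n"] u(2) by (simp_all only: has_bochner_integral_iff)
    have "u n * \<psi> (2 * real n) \<le> 6 + 4 * \<bar>\<gamma>\<bar> / \<rho> + 6 * large_jump_mass / \<rho>"
    proof -
      have "u n * \<psi> (2 * real n) \<le> u n * (6 * \<psi> (real n) + 4 * \<bar>\<gamma>\<bar> * real n + 6 * large_jump_mass)"
        using u by (intro mult_left_mono laplace_exponent_double_le) auto
      also have "\<dots> = 6 + 4 * \<bar>\<gamma>\<bar> * (real n / \<psi> (real n)) + 6 * large_jump_mass * (1 / \<psi> (real n))"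
        using \<psi> by (simp add: u(1) field_simps)
      also have "real n / \<psi> (real n) \<le> 1 / \<rho>"
        using \<psi> elim \<open>0 < \<rho>\<close> by (simp add: field_simps)
      also have "1 / \<psi> (real n) \<le> 1 / \<rho>"
      proof -
        have "\<rho> * 1 \<le> \<rho> * real n"
          using elim \<open>0 < \<rho>\<close> by (intro mult_left_mono) auto
        then have "\<rho> \<le> \<psi> (real n)"
          using elim by linarith
        then show ?thesis
          using \<open>0 < \<rho>\<close> \<psi> by (intro divide_left_mono) auto
      qed
      finally show ?thesis
        using large_jump_mass_nonneg by (simp add: mult_left_mono)
    qed
    then have EY2: "expectation (\<lambda>\<omega>. (Y \<omega>)\<^sup>2) \<le> C"
      by (simp add: Y2 C_def)
    have "AE \<omega> in M. Y \<omega> \<le> exp a + r / 2 * (Y \<omega>)\<^sup>2 + 1 / (2 * r) * indicator (space M - good) \<omega>"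
      using start AE_space
    proof eventually_elim
      case (elim \<omega>)
      show ?case
      proof (cases "\<omega> \<in> good")
        case True
        then have "real n * (X (u n) \<omega> - x) \<le> real n * (\<Delta> * u n)"
          using elim by (intro mult_left_mono) (auto simp: good_def)
        also have "\<dots> \<le> a"
          using \<psi> \<open>_ \<and> \<rho> * real n \<le> \<psi> (real n)\<close> \<open>0 < \<rho>\<close> \<open>0 < \<Delta>\<close> by (simp add: a_def u(1) field_simps)
        finally have "Y \<omega> \<le> exp a" by (simp add: Y_def)
        then show ?thesis using \<open>0 < r\<close> by (simp add: add_nonneg_nonneg add_increasing2)
      next
        case False
        \<comment> \<open>AM-GM\<close>
        have "0 \<le> (r * Y \<omega> - 1)\<^sup>2 / (2 * r)" using \<open>0 < r\<close> by simp
        also have "\<dots> = r / 2 * (Y \<omega>)\<^sup>2 + 1 / (2 * r) - Y \<omega>"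
          using \<open>0 < r\<close> by (simp add: power2_eq_square field_simps)
        finally have "Y \<omega> \<le> r / 2 * (Y \<omega>)\<^sup>2 + 1 / (2 * r)" by simp
        moreover have "indicator (space M - good) \<omega> = (1 :: real)"
          using False elim by simp
        ultimately show ?thesis
          using exp_gt_zero[of a] by (simp only: mult_1_right)
      qed
    qed
    then have "expectation Y \<le>
        expectation (\<lambda>\<omega>. exp a + r / 2 * (Y \<omega>)\<^sup>2 + 1 / (2 * r) * indicator (space M - good) \<omega>)"
      using Y Y2 by (intro integral_mono_AE Bochner_Integration.integrable_add integrable_mult_right) (auto simp: emeasure_eq_measure)
    also have "\<dots> = exp a + r / 2 * expectation (\<lambda>\<omega>. (Y \<omega>)\<^sup>2) + 1 / (2 * r) * (1 - prob good)"
      using Y2 by (simp add: prob_space prob_compl emeasure_eq_measure)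
    also have "r / 2 * expectation (\<lambda>\<omega>. (Y \<omega>)\<^sup>2) \<le> r / 2 * C"
      using EY2 \<open>0 < r\<close> by (intro mult_left_mono) auto
    also have "r / 2 * C = gap / 2"
      using \<open>0 < C\<close> by (simp add: r_def)
    finally have "gap / 2 \<le> 1 / (2 * r) * (1 - prob good)"
      by (simp add: Y gap_def field_simps)
    then have "r * gap \<le> 1 - prob good"
      using \<open>0 < r\<close> by (simp add: field_simps)
    then show ?case
      unfolding good_def by simp
  qed
  moreover have "0 < u n" for n by (auto simp: u_def)
  moreover have "1 - r * gap < 1" using \<open>0 < r\<close> \<open>0 < gap\<close> by simp
  ultimately show thesis
    using u_tendsto that by blast
qed

end

section \<open>Occupation time of a level\<close>

text \<open>For an open \<open>V\<close> containing \<open>B\<close>, each point of \<open>B\<close>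
  stays in \<open>V\<close> under small translations. Choosing \<open>V\<close> by outer regularity,
  the points translated into \<open>V - B\<close> have measure below \<open>e / 2\<close>, by
  translation invariance.\<close>

lemma measure_Int_translate_tendsto:
  fixes B :: "real set" and u :: "nat \<Rightarrow> real"
  assumes B [measurable]: "B \<in> sets borel" and fin: "emeasure lborel B < \<infinity>" and u: "u \<longlonglongrightarrow> 0"
  shows "(\<lambda>n. measure lborel {s\<in>B. s + u n \<in> B}) \<longlonglongrightarrow> measure lborel B"
proof (rule LIMSEQ_I)
  fix e :: real assume "0 < e"
  then have "0 < e / 2" by simp
  from outer_regular_lborel[OF B this] obtain V where
    V: "open V" "B \<subseteq> V" "emeasure lborel (V - B) < ennreal (e / 2)" .
  then have [measurable]: "V \<in> sets borel" by simp
  have "(\<lambda>n. LBINT s. indicat_real {s\<in>B. s + u n \<in> V} s) \<longlonglongrightarrow> (LBINT s. indicat_real B s)"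
  proof (rule integral_dominated_convergence[where w = "indicat_real B"])
    show "AE s in lborel. (\<lambda>n. indicat_real {s\<in>B. s + u n \<in> V} s) \<longlonglongrightarrow> indicat_real B s"
    proof (rule AE_I2)
      fix s :: real
      show "(\<lambda>n. indicat_real {s\<in>B. s + u n \<in> V} s) \<longlonglongrightarrow> indicat_real B s"
      proof (cases "s \<in> B")
        case True
        have "(\<lambda>n. s + u n) \<longlonglongrightarrow> s + 0"
          by (intro tendsto_add tendsto_const u)
        then have "\<forall>\<^sub>F n in sequentially. s + u n \<in> V"
          using V True by (intro topological_tendstoD) auto
        then have "\<forall>\<^sub>F n in sequentially. indicat_real {s\<in>B. s + u n \<in> V} s = indicat_real B s"
          by eventually_elim (use True in simp)
        then show ?thesis by (rule tendsto_eventually)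
      qed simp
    qed
  qed (use fin in \<open>auto simp: indicator_def intro!: integrable_real_indicator\<close>)
  then have "(\<lambda>n. measure lborel {s\<in>B. s + u n \<in> V}) \<longlonglongrightarrow> measure lborel B"
    by simp
  then obtain N where N: "\<And>n. n \<ge> N \<Longrightarrow> \<bar>measure lborel {s\<in>B. s + u n \<in> V} - measure lborel B\<bar> < e / 2"
    using LIMSEQ_D[of _ _ "e / 2"] \<open>0 < e\<close> by fastforce
  have "norm (measure lborel {s\<in>B. s + u n \<in> B} - measure lborel B) < e" if "n \<ge> N" for n
  proof -
    have shift: "emeasure lborel {s. s + u n \<in> V - B} = emeasure lborel (V - B)"
    proof -
      have "emeasure lborel (V - B) = emeasure (distr lborel borel ((+) (u n))) (V - B)"
        by (simp only: lborel_distr_plus)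
      also have "\<dots> = emeasure lborel ((+) (u n) -` (V - B) \<inter> space lborel)"
        by (rule emeasure_distr) auto
      also have "(+) (u n) -` (V - B) \<inter> space lborel = {s. s + u n \<in> V - B}"
        by (auto simp: add.commute)
      finally show ?thesis ..
    qed
    have fm: "{s\<in>B. s + u n \<in> B} \<in> fmeasurable lborel" "{s. s + u n \<in> V - B} \<in> fmeasurable lborel"
      "B \<in> fmeasurable lborel"
    proof -
      have "emeasure lborel {s\<in>B. s + u n \<in> B} \<le> emeasure lborel B"
        by (intro emeasure_mono) auto
      then show "{s\<in>B. s + u n \<in> B} \<in> fmeasurable lborel"
        using fin by (intro fmeasurableI) auto
      show "{s. s + u n \<in> V - B} \<in> fmeasurable lborel"
        using V(3) shift by (intro fmeasurableI) (auto simp: less_top[symmetric])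
    qed (use fin in \<open>auto intro: fmeasurableI\<close>)
    have "measure lborel {s\<in>B. s + u n \<in> V} \<le> measure lborel ({s\<in>B. s + u n \<in> B} \<union> {s. s + u n \<in> V - B})"
      using fm by (intro measure_mono_fmeasurable fmeasurable.Un) auto
    also have "\<dots> \<le> measure lborel {s\<in>B. s + u n \<in> B} + measure lborel {s. s + u n \<in> V - B}"
      using fm by (intro measure_Un_le) auto
    also have "measure lborel {s. s + u n \<in> V - B} < e / 2"
    proof -
      have "ennreal (measure lborel {s. s + u n \<in> V - B}) < ennreal (e / 2)"
        using V(3) shift fm(2) by (simp add: emeasure_eq_measure2)
      then show ?thesis by (simp add: ennreal_less_iff)
    qed
    finally have "measure lborel B - e < measure lborel {s\<in>B. s + u n \<in> B}"
      using N[OF that] unfolding abs_less_iff by linarith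
    moreover have "measure lborel {s\<in>B. s + u n \<in> B} \<le> measure lborel B"
      using fm by (intro measure_mono_fmeasurable) auto
    ultimately show ?thesis using \<open>0 < e\<close> by simp
  qed
  then show "\<exists>N. \<forall>n\<ge>N. norm (measure lborel {s\<in>B. s + u n \<in> B} - measure lborel B) < e"
    by blast
qed

text \<open>Fubini needs joint measurability, but \<open>U\<close> is right-continuous only almost
  surely. \<open>W\<close> is therefore a total limit of processes that take countably many time
  values, and agrees with \<open>U\<close> on the good paths.\<close>

lemma right_continuous_process_joint_version:
  fixes U :: "real \<Rightarrow> 'a \<Rightarrow> real"
  assumes U: "\<And>t. 0 \<le> t \<Longrightarrow> U t \<in> borel_measurable M"
    and cont: "AE \<omega> in M. \<forall>t\<ge>0. continuous (at_right t) (\<lambda>t. U t \<omega>)"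
  obtains W where "(\<lambda>(s, \<omega>). W s \<omega>) \<in> borel_measurable (lborel \<Otimes>\<^sub>M M)"
    "AE \<omega> in M. \<forall>t\<ge>0. W t \<omega> = U t \<omega>"
proof
  \<comment> \<open>The successor puts the sampling time strictly to the right of
    \<open>s \<ge> 0\<close>, as the right limit requires; for negative \<open>s\<close> it is still
    a positive time, where \<open>U\<close> is measurable.\<close>
  define g where "g n s = real (Suc (nat \<lfloor>real (Suc n) * s\<rfloor>)) / real (Suc n)" for n s
  define W where "W s \<omega> = lim (\<lambda>n. U (g n s) \<omega>)" for s \<omega>
  have "(\<lambda>p. U (g n (fst p)) (snd p)) \<in> borel_measurable (lborel \<Otimes>\<^sub>M M)" for n
  proof -
    have "(\<lambda>p. U (real (Suc j) / real (Suc n)) (snd p)) \<in> borel_measurable (lborel \<Otimes>\<^sub>M M)" for j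
      by (rule measurable_compose[OF measurable_snd U]) simp
    then have "(\<lambda>p. (\<lambda>j p. U (real (Suc j) / real (Suc n)) (snd p)) (nat \<lfloor>real (Suc n) * fst p\<rfloor>) p)
        \<in> borel_measurable (lborel \<Otimes>\<^sub>M M)"
      by (rule measurable_compose_countable) measurable
    then show ?thesis by (simp add: g_def)
  qed
  then have "(\<lambda>p. lim (\<lambda>n. U (g n (fst p)) (snd p))) \<in> borel_measurable (lborel \<Otimes>\<^sub>M M)"
    by (rule borel_measurable_lim_metric)
  then show "(\<lambda>(s, \<omega>). W s \<omega>) \<in> borel_measurable (lborel \<Otimes>\<^sub>M M)"
    by (simp add: W_def case_prod_beta)
  show "AE \<omega> in M. \<forall>t\<ge>0. W t \<omega> = U t \<omega>"
    using cont
  proof eventually_elim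
    case (elim \<omega>)
    show ?case
    proof (intro allI impI)
      fix t :: real assume "0 \<le> t"
      have bounds: "t < g n t" "g n t \<le> t + 1 / real (Suc n)" for n
      proof -
        have "0 \<le> real (Suc n) * t" using \<open>0 \<le> t\<close> by simp
        then have "real (Suc n) * t < real (Suc (nat \<lfloor>real (Suc n) * t\<rfloor>))"
          "real (Suc (nat \<lfloor>real (Suc n) * t\<rfloor>)) \<le> real (Suc n) * t + 1"
          by linarith+
        moreover have "(t + 1 / real (Suc n)) * real (Suc n) = t * real (Suc n) + 1"
          by (simp add: distrib_right del: of_nat_Suc)
        ultimately show "t < g n t" "g n t \<le> t + 1 / real (Suc n)"
          unfolding g_def by (simp_all add: pos_less_divide_eq pos_divide_le_eq mult.commute del: of_nat_Suc)
      qed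
      have "(\<lambda>n. t + 1 / real (Suc n)) \<longlonglongrightarrow> t + 0"
        using LIMSEQ_inverse_real_of_nat by (intro tendsto_add tendsto_const) (simp add: inverse_eq_divide)
      then have "(\<lambda>n. g n t) \<longlonglongrightarrow> t"
        using bounds by (intro real_tendsto_sandwich[of "\<lambda>_. t" "\<lambda>n. g n t" _ "\<lambda>n. t + 1 / real (Suc n)"])
          (auto intro!: always_eventually less_imp_le simp del: of_nat_Suc)
      then have "filterlim (\<lambda>n. g n t) (at_right t) sequentially"
        using bounds(1) by (intro tendsto_imp_filterlim_at_right always_eventually allI)
      moreover have "((\<lambda>t. U t \<omega>) \<longlongrightarrow> U t \<omega>) (at_right t)"
        using elim \<open>0 \<le> t\<close> by (simp add: continuous_within)
      ultimately have "(\<lambda>n. U (g n t) \<omega>) \<longlonglongrightarrow> U t \<omega>"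
        by (rule filterlim_compose[rotated])
      then show "W t \<omega> = U t \<omega>"
        unfolding W_def by (rule limI)
    qed
  qed
qed

context levy_process
begin

text \<open>If \<open>m\<close> is the expected time that \<open>U\<close> spends at \<open>b\<close> up to time \<open>T\<close>, then independence of the
  increments bounds the expected measure of the \<open>s\<close> with \<open>U s = U (s + u) = b\<close> by \<open>q m\<close>, whereas
  by continuity of translations it tends to \<open>m\<close> as \<open>u \<rightarrow> 0\<close>.\<close>

lemma occupation_time_level_eq_0:
  fixes U :: "real \<Rightarrow> 'a \<Rightarrow> real" and u :: "nat \<Rightarrow> real"
  assumes U: "\<And>t. 0 \<le> t \<Longrightarrow> U t \<in> borel_measurable (F t)"
    and cont: "AE \<omega> in M. \<forall>t\<ge>0. continuous (at_right t) (\<lambda>t. U t \<omega>)"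
    and slope: "AE \<omega> in M. \<forall>s\<ge>0. \<forall>t\<ge>s. (U t \<omega> - X t \<omega>) - (U s \<omega> - X s \<omega>) \<in> {- \<Delta> * (t - s)..0}"
    and u: "\<And>n. 0 < u n" "u \<longlonglongrightarrow> 0" and q: "q < 1"
      "\<forall>\<^sub>F n in sequentially. prob {\<omega>\<in>space M. X (u n) \<omega> - X 0 \<omega> \<in> {0..\<Delta> * u n}} \<le> q"
  shows "AE \<omega> in M. AE s in lborel. 0 \<le> s \<longrightarrow> U s \<omega> \<noteq> b"
proof -
  have U_M: "U t \<in> borel_measurable M" if "0 \<le> t" for t
    using U[OF that] subalgebra_F by (blast intro: measurable_from_subalg)
  obtain W where W [measurable]: "(\<lambda>(s, \<omega>). W s \<omega>) \<in> borel_measurable (lborel \<Otimes>\<^sub>M M)"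
    and WU: "AE \<omega> in M. \<forall>t\<ge>0. W t \<omega> = U t \<omega>"
    using right_continuous_process_joint_version[OF U_M cont] by blast
  have W1 [measurable]: "W s \<in> borel_measurable M" for s
    using measurable_Pair2[OF W] by simp
  have W2 [measurable]: "(\<lambda>s. W s \<omega>) \<in> borel_measurable borel" if "\<omega> \<in> space M" for \<omega>
    using measurable_Pair1[OF W that] by simp
  interpret P: pair_sigma_finite lborel M ..
  have null: "AE \<omega> in M. emeasure lborel {s\<in>{0..T}. W s \<omega> = b} = 0" for T
  proof -
    define B where "B \<omega> = {s\<in>{0..T}. W s \<omega> = b}" for \<omega>
    define A where "A = {p\<in>space (lborel \<Otimes>\<^sub>M M). fst p \<in> {0..T} \<and> W (fst p) (snd p) = b}"
    define A' where "A' n = {p\<in>space (lborel \<Otimes>\<^sub>M M). p \<in> A \<and> (fst p + u n, snd p) \<in> A}" for n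
    have Wm: "(\<lambda>p. W (fst p) (snd p)) \<in> borel_measurable (lborel \<Otimes>\<^sub>M M)"
      using W by (simp add: case_prod_beta)
    have A: "A \<in> sets (lborel \<Otimes>\<^sub>M M)"
      unfolding A_def using Wm by measurable
    have A': "A' n \<in> sets (lborel \<Otimes>\<^sub>M M)" for n
    proof -
      have "(\<lambda>p. (fst p + u n, snd p)) \<in> (lborel \<Otimes>\<^sub>M M) \<rightarrow>\<^sub>M (lborel \<Otimes>\<^sub>M M)"
        by measurable
      then show ?thesis
        unfolding A'_def using A by measurable
    qed
    have B: "B \<omega> \<in> sets borel" "emeasure lborel (B \<omega>) \<le> ennreal \<bar>T\<bar>" if "\<omega> \<in> space M" for \<omega>
    proof -
      show "B \<omega> \<in> sets borel"
        unfolding B_def using W2[OF that] by measurable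
      have "emeasure lborel (B \<omega>) \<le> emeasure lborel {0..T}"
        by (intro emeasure_mono) (auto simp: B_def)
      also have "\<dots> \<le> ennreal \<bar>T\<bar>"
        by (simp add: emeasure_lborel_Icc_eq)
      finally show "emeasure lborel (B \<omega>) \<le> ennreal \<bar>T\<bar>" .
    qed
    have B_fin: "emeasure lborel (B \<omega>) < \<infinity>" if "\<omega> \<in> space M" for \<omega>
      using B(2)[OF that] by (simp add: le_less_trans)
    have section_A: "(\<lambda>s. (s, \<omega>)) -` A = B \<omega>" and section_A': "(\<lambda>s. (s, \<omega>)) -` A' n = {s\<in>B \<omega>. s + u n \<in> B \<omega>}"
      if "\<omega> \<in> space M" for \<omega> n
      using that by (auto simp: A_def A'_def B_def space_pair_measure)
    have int_A: "emeasure (lborel \<Otimes>\<^sub>M M) A = (\<integral>\<^sup>+ \<omega>. emeasure lborel (B \<omega>) \<partial>M)"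
      unfolding P.emeasure_pair_measure_alt2[OF A] by (intro nn_integral_cong) (simp add: section_A)
    have int_A': "emeasure (lborel \<Otimes>\<^sub>M M) (A' n) = (\<integral>\<^sup>+ \<omega>. emeasure lborel {s\<in>B \<omega>. s + u n \<in> B \<omega>} \<partial>M)" for n
      unfolding P.emeasure_pair_measure_alt2[OF A'] by (intro nn_integral_cong) (simp add: section_A')
    have B_meas: "(\<lambda>\<omega>. emeasure lborel (B \<omega>)) \<in> borel_measurable M"
      using P.measurable_emeasure_Pair2[OF A] by (rule measurable_cong[THEN iffD1, rotated]) (simp add: section_A)
    have B'_meas: "(\<lambda>\<omega>. emeasure lborel {s\<in>B \<omega>. s + u n \<in> B \<omega>}) \<in> borel_measurable M" for n
      using P.measurable_emeasure_Pair2[OF A'] by (rule measurable_cong[THEN iffD1, rotated]) (simp add: section_A')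
    have lim: "(\<lambda>n. emeasure (lborel \<Otimes>\<^sub>M M) (A' n)) \<longlonglongrightarrow> emeasure (lborel \<Otimes>\<^sub>M M) A"
      unfolding int_A int_A'
    proof (rule nn_integral_dominated_convergence[where w = "\<lambda>_. ennreal \<bar>T\<bar>"])
      show "AE \<omega> in M. emeasure lborel {s\<in>B \<omega>. s + u n \<in> B \<omega>} \<le> ennreal \<bar>T\<bar>" for n
      proof (rule AE_I2)
        fix \<omega> assume \<omega>: "\<omega> \<in> space M"
        have "emeasure lborel {s\<in>B \<omega>. s + u n \<in> B \<omega>} \<le> emeasure lborel (B \<omega>)"
          using B(1)[OF \<omega>] by (intro emeasure_mono) auto
        also note B(2)[OF \<omega>]
        finally show "emeasure lborel {s\<in>B \<omega>. s + u n \<in> B \<omega>} \<le> ennreal \<bar>T\<bar>" .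
      qed
      show "AE \<omega> in M. (\<lambda>n. emeasure lborel {s\<in>B \<omega>. s + u n \<in> B \<omega>}) \<longlonglongrightarrow> emeasure lborel (B \<omega>)"
      proof (rule AE_I2)
        fix \<omega> assume \<omega>: "\<omega> \<in> space M"
        have fin: "emeasure lborel C = ennreal (measure lborel C)" if "C \<subseteq> B \<omega>" for C
          using emeasure_mono[OF that, of lborel] B[OF \<omega>] B_fin[OF \<omega>]
          by (intro emeasure_eq_ennreal_measure) (auto simp: top_unique)
        have "(\<lambda>n. ennreal (measure lborel {s\<in>B \<omega>. s + u n \<in> B \<omega>})) \<longlonglongrightarrow> ennreal (measure lborel (B \<omega>))"
          by (intro tendsto_ennrealI measure_Int_translate_tendsto B(1) B_fin u(2) \<omega>)
        moreover have "emeasure lborel {s\<in>B \<omega>. s + u n \<in> B \<omega>} = ennreal (measure lborel {s\<in>B \<omega>. s + u n \<in> B \<omega>})" for n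
          by (rule fin) auto
        ultimately show "(\<lambda>n. emeasure lborel {s\<in>B \<omega>. s + u n \<in> B \<omega>}) \<longlonglongrightarrow> emeasure lborel (B \<omega>)"
          using fin[of "B \<omega>"] by simp
      qed
    qed (use B_meas B'_meas in \<open>auto simp: emeasure_space_1\<close>)
    have le: "\<forall>\<^sub>F n in sequentially. emeasure (lborel \<Otimes>\<^sub>M M) (A' n) \<le> ennreal q * emeasure (lborel \<Otimes>\<^sub>M M) A"
      using q(2)
    proof eventually_elim
      case (elim n)
      have "emeasure M (Pair s -` A' n) \<le> ennreal q * emeasure M (Pair s -` A)" for s
      proof (cases "s \<in> {0..T}")
        case False
        then have "Pair s -` A' n = {}" by (auto simp: A'_def A_def)
        then show ?thesis by simp
      next
        case True
        \<comment> \<open>Defined by \<open>U\<close> and not by \<open>W\<close>: independence of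
          the later increment requires an event of \<open>F s\<close>, and \<open>W s\<close> looks
          at times after \<open>s\<close>.\<close>
        define G where "G = {\<omega>\<in>space M. U s \<omega> = b}"
        have "G \<in> sets (F s)"
        proof -
          have "U s -` {b} \<inter> space (F s) \<in> sets (F s)"
            using U[of s] True by (intro measurable_sets) auto
          moreover have "U s -` {b} \<inter> space (F s) = G"
            using subalgebra_F[of s] by (auto simp: G_def subalgebra_def)
          ultimately show ?thesis by simp
        qed
        then have "G \<in> sets M"
          using subalgebra_F[of s] by (auto simp: subalgebra_def)
        have s_nonneg: "0 \<le> s" "0 \<le> s + u n" "s \<le> s + u n"
          using True u(1)[of n] by auto
        define J where "J = {\<omega>\<in>space M. \<omega> \<in> G \<and> X (s + u n) \<omega> - X s \<omega> \<in> {0..\<Delta> * u n}}"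
        have "J \<in> sets M"
          using \<open>G \<in> sets M\<close> borel_measurable_increment[OF s_nonneg(1,2)] unfolding J_def by measurable
        have "AE \<omega> in M. \<omega> \<in> Pair s -` A' n \<longrightarrow> \<omega> \<in> J"
          using WU slope AE_space
        proof eventually_elim
          case (elim \<omega>)
          show ?case
          proof
            assume "\<omega> \<in> Pair s -` A' n"
            then have "U s \<omega> = b" "U (s + u n) \<omega> = b"
              using elim(1) s_nonneg by (auto simp: A'_def A_def)
            then show "\<omega> \<in> J"
              using elim(2)[rule_format, OF s_nonneg(1,3)] elim(3) by (auto simp: J_def G_def)
          qed
        qed
        then have "emeasure M (Pair s -` A' n) \<le> emeasure M J"
          using \<open>J \<in> sets M\<close> by (rule emeasure_mono_AE)
        also have "emeasure M J = ennreal (prob G * prob {\<omega>\<in>space M. X (u n) \<omega> - X 0 \<omega> \<in> {0..\<Delta> * u n}})"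
          using prob_indep_increment[OF s_nonneg(1,3) \<open>G \<in> sets (F s)\<close>, of "{0..\<Delta> * u n}"]
          by (simp add: emeasure_eq_measure J_def)
        also have "\<dots> \<le> ennreal (prob G * q)"
          using elim by (intro ennreal_leI mult_left_mono) auto
        also have "\<dots> = ennreal q * emeasure M G"
          using order_trans[OF measure_nonneg elim] by (simp add: emeasure_eq_measure ennreal_mult' mult.commute)
        also have "emeasure M G = emeasure M (Pair s -` A)"
        proof (rule emeasure_eq_AE)
          show "AE \<omega> in M. \<omega> \<in> G \<longleftrightarrow> \<omega> \<in> Pair s -` A"
            using WU AE_space
            by eventually_elim (use True in \<open>auto simp: G_def A_def space_pair_measure\<close>)
          show "Pair s -` A \<in> sets M"
            using A by (rule sets_Pair1)
        qed fact
        finally show ?thesis .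
      qed
      then have "emeasure (lborel \<Otimes>\<^sub>M M) (A' n) \<le> (\<integral>\<^sup>+ s. ennreal q * emeasure M (Pair s -` A) \<partial>lborel)"
        unfolding emeasure_pair_measure_alt[OF A'] by (intro nn_integral_mono)
      also have "\<dots> = ennreal q * emeasure (lborel \<Otimes>\<^sub>M M) A"
        unfolding emeasure_pair_measure_alt[OF A]
        using measurable_emeasure_Pair[OF A] by (intro nn_integral_cmult) simp
      finally show ?case .
    qed
    have "emeasure (lborel \<Otimes>\<^sub>M M) A \<le> ennreal q * emeasure (lborel \<Otimes>\<^sub>M M) A"
      by (rule tendsto_upperbound[OF lim le]) simp
    moreover have "emeasure (lborel \<Otimes>\<^sub>M M) A < \<infinity>"
    proof -
      have "(\<integral>\<^sup>+ \<omega>. emeasure lborel (B \<omega>) \<partial>M) \<le> (\<integral>\<^sup>+ \<omega>. ennreal \<bar>T\<bar> \<partial>M)"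
        using B(2) by (intro nn_integral_mono)
      then show ?thesis
        unfolding int_A by (simp add: emeasure_space_1 le_less_trans)
    qed
    ultimately have "emeasure (lborel \<Otimes>\<^sub>M M) A = 0"
    proof -
      assume le: "emeasure (lborel \<Otimes>\<^sub>M M) A \<le> ennreal q * emeasure (lborel \<Otimes>\<^sub>M M) A"
        and "emeasure (lborel \<Otimes>\<^sub>M M) A < \<infinity>"
      then obtain m where m: "emeasure (lborel \<Otimes>\<^sub>M M) A = ennreal m" "0 \<le> m"
        by (cases "emeasure (lborel \<Otimes>\<^sub>M M) A") auto
      \<comment> \<open>\<open>ennreal q\<close> is 0 for negative \<open>q\<close>, hence the
        maximum.\<close>
      have "ennreal m \<le> ennreal (max 0 q * m)"
        using le m by (cases "0 \<le> q") (simp_all add: ennreal_mult max_def ennreal_neg)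
      then have "m \<le> max 0 q * m"
        using m by (subst (asm) ennreal_le_iff) auto
      then have "m * (1 - max 0 q) \<le> 0" by (simp add: algebra_simps)
      then have "m \<le> 0"
        using q(1) by (auto simp: mult_le_0_iff max_def split: if_splits)
      then show ?thesis using m by simp
    qed
    then have "AE \<omega> in M. emeasure lborel (B \<omega>) = 0"
      unfolding int_A using nn_integral_0_iff_AE[OF B_meas] by simp
    then show ?thesis by (simp add: B_def)
  qed
  have "AE \<omega> in M. \<forall>n::nat. emeasure lborel {s\<in>{0..real n}. W s \<omega> = b} = 0"
    unfolding AE_all_countable using null by blast
  then show ?thesis
    using WU AE_space
  proof eventually_elim
    case (elim \<omega>)
    have "{s\<in>{0..real n}. W s \<omega> = b} \<in> null_sets lborel" for n
      using elim(1) W2[OF elim(3)] by (auto simp: null_sets_def)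
    then have "AE s in lborel. \<forall>n. s \<notin> {s\<in>{0..real n}. W s \<omega> = b}"
      unfolding AE_all_countable by (blast intro: AE_not_in)
    then show ?case
    proof eventually_elim
      case (elim s)
      show ?case
      proof
        assume "0 \<le> s"
        moreover obtain n where "s \<le> real n" using real_arch_simple by blast
        ultimately show "U s \<omega> \<noteq> b"
          using elim[rule_format, of n] \<open>\<forall>t\<ge>0. W t \<omega> = U t \<omega>\<close> by auto
      qed
    qed
  qed
qed

end

section \<open>Strong solutions\<close>

lemma isCont_indicator_greaterThan:
  fixes a u :: real
  assumes "u \<noteq> a"
  shows "isCont (indicat_real {a<..}) u"
  using assms by (simp add: isCont_indicator frontier_def interior_open)

lemma set_integral_drift:
  fixes u :: "real \<Rightarrow> real" and \<delta> b :: "nat \<Rightarrow> real"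
  assumes "\<forall>i\<in>I. set_integrable lborel A (\<lambda>s. indicat_real {b i<..} (u s))"
  shows "set_integrable lborel A (\<lambda>s. \<Sum>i\<in>I. \<delta> i * indicat_real {b i<..} (u s))"
    and "(LBINT s:A. \<Sum>i\<in>I. \<delta> i * indicat_real {b i<..} (u s)) =
      (\<Sum>i\<in>I. \<delta> i * (LBINT s:A. indicat_real {b i<..} (u s)))"
proof -
  have int: "integrable lborel (\<lambda>s. indicat_real A s *\<^sub>R (\<delta> i * indicat_real {b i<..} (u s)))" if "i \<in> I" for i
    using set_integrable_mult_right[OF assms[rule_format, OF that], of "\<delta> i"] by (simp add: set_integrable_def)
  then show "set_integrable lborel A (\<lambda>s. \<Sum>i\<in>I. \<delta> i * indicat_real {b i<..} (u s))"
    unfolding set_integrable_def scaleR_sum_right by (rule Bochner_Integration.integrable_sum)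
  have "(LBINT s:A. \<Sum>i\<in>I. \<delta> i * indicat_real {b i<..} (u s)) =
      (\<Sum>i\<in>I. LBINT s:A. \<delta> i * indicat_real {b i<..} (u s))"
    unfolding set_lebesgue_integral_def scaleR_sum_right using int by (rule Bochner_Integration.integral_sum)
  then show "(LBINT s:A. \<Sum>i\<in>I. \<delta> i * indicat_real {b i<..} (u s)) =
      (\<Sum>i\<in>I. \<delta> i * (LBINT s:A. indicat_real {b i<..} (u s)))"
    by simp
qed

lemma bounded_mono_drift:
  fixes \<delta> b :: "nat \<Rightarrow> real"
  assumes "\<And>i. i \<in> I \<Longrightarrow> 0 \<le> \<delta> i"
  shows "bounded_mono (\<lambda>u. \<Sum>i\<in>I. \<delta> i * indicat_real {b i<..} u) (\<Sum>i\<in>I. \<delta> i)"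
proof
  show "mono (\<lambda>u. \<Sum>i\<in>I. \<delta> i * indicat_real {b i<..} u)"
    using assms by (intro monoI sum_mono mult_left_mono) (auto simp: indicator_def)
  show "0 \<le> (\<Sum>i\<in>I. \<delta> i * indicat_real {b i<..} u)" for u
    using assms by (intro sum_nonneg mult_nonneg_nonneg) auto
  show "(\<Sum>i\<in>I. \<delta> i * indicat_real {b i<..} u) \<le> (\<Sum>i\<in>I. \<delta> i)" for u
    using assms by (intro sum_mono) (simp add: indicator_def)
qed

lemma strong_solution_unique:
  fixes \<delta> b :: "nat \<Rightarrow> real"
  assumes \<delta>: "\<And>i. i \<in> {1..k} \<Longrightarrow> 0 \<le> \<delta> i"
    and U: "strong_solution M F X k \<delta> b U" and V: "strong_solution M F X k \<delta> b V"
  shows "indistinguishable M U V"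
proof -
  let ?\<phi> = "\<lambda>u. \<Sum>i=1..k. \<delta> i * indicat_real {b i<..} u"
  interpret bounded_mono ?\<phi> "\<Sum>i=1..k. \<delta> i"
    by (intro bounded_mono_drift \<delta>)
  have drift: "AE \<omega> in M. \<forall>t\<ge>0. set_integrable lborel {0..t} (\<lambda>s. ?\<phi> (W s \<omega>)) \<and>
      W t \<omega> = X t \<omega> - (LBINT s:{0..t}. ?\<phi> (W s \<omega>))"
    if W: "strong_solution M F X k \<delta> b W" for W
  proof -
    have "AE \<omega> in M. \<forall>t\<ge>0.
        (\<forall>i\<in>{1..k}. set_integrable lborel {0..t} (\<lambda>s. indicat_real {b i<..} (W s \<omega>))) \<and>
        W t \<omega> = X t \<omega> - (\<Sum>i=1..k. \<delta> i * (LBINT s:{0..t}. indicat_real {b i<..} (W s \<omega>)))"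
      using W unfolding strong_solution_def by (rule conjunct2)
    then show ?thesis
    proof eventually_elim
      case (elim \<omega>)
      show ?case
      proof (intro allI impI)
        fix t :: real assume "0 \<le> t"
        with elim have int: "\<forall>i\<in>{1..k}. set_integrable lborel {0..t} (\<lambda>s. indicat_real {b i<..} (W s \<omega>))"
          and eq: "W t \<omega> = X t \<omega> - (\<Sum>i=1..k. \<delta> i * (LBINT s:{0..t}. indicat_real {b i<..} (W s \<omega>)))"
          by blast+
        note drift = set_integral_drift[where I = "{1..k}" and \<delta> = \<delta> and b = b and u = "\<lambda>s. W s \<omega>", OF int]
        show "set_integrable lborel {0..t} (\<lambda>s. ?\<phi> (W s \<omega>)) \<and>
            W t \<omega> = X t \<omega> - (LBINT s:{0..t}. ?\<phi> (W s \<omega>))"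
          using drift(1) eq unfolding drift(2) by (rule conjI)
      qed
    qed
  qed
  show ?thesis
    unfolding indistinguishable_def using drift[OF U] drift[OF V]
  proof eventually_elim
    case (elim \<omega>)
    show ?case
    proof (intro allI impI)
      fix t :: real assume "0 \<le> t"
      show "U t \<omega> = V t \<omega>"
      proof (rule antisym)
        show "U t \<omega> \<le> V t \<omega>"
          by (rule integral_equation_le[where f = "\<lambda>t. X t \<omega>" and u = "\<lambda>t. U t \<omega>" and v = "\<lambda>t. V t \<omega>"])
            (use elim \<open>0 \<le> t\<close> in auto)
        show "V t \<omega> \<le> U t \<omega>"
          by (rule integral_equation_le[where f = "\<lambda>t. X t \<omega>" and u = "\<lambda>t. V t \<omega>" and v = "\<lambda>t. U t \<omega>"])
            (use elim \<open>0 \<le> t\<close> in auto)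
      qed
    qed
  qed
qed

lemma (in spectrally_negative_levy_process) strong_solution_exists:
  fixes \<delta> b :: "nat \<Rightarrow> real"
  assumes \<delta>: "\<And>i. i \<in> {1..k} \<Longrightarrow> 0 \<le> \<delta> i" and pos: "0 < (\<Sum>i=1..k. \<delta> i)"
    and drift: "bounded_variation_paths M X \<Longrightarrow> (\<Sum>i=1..k. \<delta> i) < levy_drift \<gamma> \<nu>"
  shows "\<exists>U. strong_solution M F X k \<delta> b U"
proof -
  let ?\<phi> = "\<lambda>u. \<Sum>i=1..k. \<delta> i * indicat_real {b i<..} u"
  define \<Delta> where "\<Delta> = (\<Sum>i=1..k. \<delta> i)"
  interpret bounded_mono ?\<phi> \<Delta>
    unfolding \<Delta>_def by (intro bounded_mono_drift \<delta>)
  \<comment> \<open>The pathwise results ask for countably many discontinuities on the whole line,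
    and nothing is assumed about \<open>X\<close> at negative times.\<close>
  define Y where "Y \<omega> t = X (max 0 t) \<omega>" for \<omega> t
  define U where "U t \<omega> = X t \<omega> + euler_limit (Y \<omega>) t" for t \<omega>
  have U_meas: "U t \<in> borel_measurable (F t)" if "0 \<le> t" for t
  proof -
    have "(\<lambda>\<omega>. Y \<omega> s) \<in> borel_measurable (F t)" if "0 \<le> s" "s \<le> t" for s
    proof -
      have "borel_measurable (F s) \<subseteq> borel_measurable (F t)"
        by (rule measurable_mono) (use sets_F_mono[OF that(2)] in \<open>simp_all add: space_F\<close>)
      then have "X s \<in> borel_measurable (F t)"
        using adapted[OF that(1)] by blast
      moreover have "(\<lambda>\<omega>. Y \<omega> s) = X s"
        using that(1) by (simp add: Y_def fun_eq_iff)
      ultimately show ?thesis by (simp only:)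
    qed
    then have "(\<lambda>\<omega>. euler_limit (Y \<omega>) t) \<in> borel_measurable (F t)"
      using that by (intro borel_measurable_euler_limit)
    then show ?thesis
      unfolding U_def using adapted[OF that] by (intro borel_measurable_add)
  qed
  have discont: "AE \<omega> in M. countable {t. \<not> isCont (Y \<omega>) t}"
    using cadlag_paths
  proof eventually_elim
    case (elim \<omega>)
    have "isCont (Y \<omega>) t" if "t < 0" for t
    proof -
      have "\<forall>\<^sub>F s in nhds t. Y \<omega> s = X 0 \<omega>"
        using that by (intro eventually_mono[OF eventually_nhds_in_open[of "{..<0}" t]]) (auto simp: Y_def)
      then have "isCont (Y \<omega>) t \<longleftrightarrow> isCont (\<lambda>_. X 0 \<omega>) t"
        by (rule isCont_cong)
      then show ?thesis by simp
    qed
    moreover have "isCont (Y \<omega>) t \<longleftrightarrow> isCont (\<lambda>t. X t \<omega>) t" if "0 < t" for t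
      using that by (intro isCont_cong eventually_mono[OF eventually_nhds_in_open[of "{0<..}" t]]) (auto simp: Y_def)
    ultimately have "{t. \<not> isCont (Y \<omega>) t} \<subseteq> insert 0 {t. 0 < t \<and> \<not> isCont (\<lambda>t. X t \<omega>) t}"
      using linorder_less_linear[where y = 0] by blast
    then show ?case
      using countable_not_isCont_cadlag[OF elim] by (rule countable_subset[OF _ countable_insert])
  qed
  have U_cont: "AE \<omega> in M. \<forall>t\<ge>0. continuous (at_right t) (\<lambda>t. U t \<omega>)"
    using discont cadlag_paths
  proof eventually_elim
    case (elim \<omega>)
    show ?case
    proof (intro allI impI)
      fix t :: real assume "0 \<le> t"
      then have "continuous (at t within {0..}) (euler_limit (Y \<omega>))"
        using euler_limit_continuous_on[OF elim(1)] by (simp add: continuous_on_eq_continuous_within)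
      then have "continuous (at_right t) (euler_limit (Y \<omega>))"
        by (rule continuous_within_subset) (use \<open>0 \<le> t\<close> in auto)
      then show "continuous (at_right t) (\<lambda>t. U t \<omega>)"
        unfolding U_def using elim(2) \<open>0 \<le> t\<close> by (intro continuous_add) (simp_all add: cadlag_def)
    qed
  qed
  have slope: "AE \<omega> in M. \<forall>s\<ge>0. \<forall>t\<ge>s. (U t \<omega> - X t \<omega>) - (U s \<omega> - X s \<omega>) \<in> {- \<Delta> * (t - s)..0}"
    using discont by eventually_elim (simp add: U_def euler_limit_diff[simplified])
  obtain u q where u: "\<And>n. 0 < u n" "u \<longlonglongrightarrow> (0 :: real)" and q: "q < 1"
    "\<forall>\<^sub>F n in sequentially. prob {\<omega>\<in>space M. X (u n) \<omega> - X 0 \<omega> \<in> {0..\<Delta> * u n}} \<le> q"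
    using prob_slow_increment_bounded_away_from_1[of \<Delta>] drift pos unfolding \<Delta>_def by blast
  \<comment> \<open>Finitely many levels, so the null sets may depend on the level. Away from all
    levels \<open>\<phi>\<close> is continuous, which is the hypothesis of the limit
    equation.\<close>
  have "AE \<omega> in M. \<forall>i\<in>{1..k}. AE s in lborel. 0 \<le> s \<longrightarrow> U s \<omega> \<noteq> b i"
    by (intro AE_finite_allI occupation_time_level_eq_0[OF U_meas U_cont slope u q]) auto
  then have "AE \<omega> in M. \<forall>t\<ge>0.
      (\<forall>i\<in>{1..k}. set_integrable lborel {0..t} (\<lambda>s. indicat_real {b i<..} (U s \<omega>))) \<and>
      U t \<omega> = X t \<omega> - (\<Sum>i=1..k. \<delta> i * (LBINT s:{0..t}. indicat_real {b i<..} (U s \<omega>)))"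
    using discont
  proof eventually_elim
    case (elim \<omega>)
    have U_eq: "U s \<omega> = Y \<omega> s + euler_limit (Y \<omega>) s" if "0 \<le> s" for s
      using that by (simp add: U_def Y_def)
    have "AE s in lborel. \<forall>i\<in>{1..k}. 0 \<le> s \<longrightarrow> U s \<omega> \<noteq> b i"
      using elim(1) by (intro AE_finite_allI) auto
    then have "AE s in lborel. 0 \<le> s \<longrightarrow> isCont ?\<phi> (Y \<omega> s + euler_limit (Y \<omega>) s)"
    proof eventually_elim
      case (elim s)
      show ?case
      proof
        assume "0 \<le> s"
        then show "isCont ?\<phi> (Y \<omega> s + euler_limit (Y \<omega>) s)"
          using elim U_eq[of s]
          by (intro continuous_sum continuous_mult continuous_const isCont_indicator_greaterThan) auto
      qed
    qed
    note limit_eq = euler_limit_eq_integral[OF elim(2) _ this]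
    show ?case
    proof (intro allI impI)
      fix t :: real assume "0 \<le> t"
      have int: "\<forall>i\<in>{1..k}. set_integrable lborel {0..t} (\<lambda>s. indicat_real {b i<..} (U s \<omega>))"
      proof
        fix i
        have "set_integrable lborel {0..t} (\<lambda>s. indicat_real {b i<..} (Y \<omega> s + euler_limit (Y \<omega>) s))"
          by (rule set_integrable_solution[OF elim(2), where C = 1]) (auto simp: indicator_def)
        then show "set_integrable lborel {0..t} (\<lambda>s. indicat_real {b i<..} (U s \<omega>))"
          by (rule set_integrable_cong[THEN iffD1, rotated -1]) (auto simp: U_eq)
      qed
      have "euler_limit (Y \<omega>) t = - (LBINT s:{0..t}. ?\<phi> (U s \<omega>))"
        unfolding limit_eq[OF \<open>0 \<le> t\<close>]
        by (intro arg_cong[where f = uminus] set_lebesgue_integral_cong) (auto simp: U_eq)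
      then have "U t \<omega> = X t \<omega> - (\<Sum>i=1..k. \<delta> i * (LBINT s:{0..t}. indicat_real {b i<..} (U s \<omega>)))"
        unfolding set_integral_drift(2)[where \<delta> = \<delta> and I = "{1..k}", OF int] U_def[of t] by linarith
      with int show "(\<forall>i\<in>{1..k}. set_integrable lborel {0..t} (\<lambda>s. indicat_real {b i<..} (U s \<omega>))) \<and>
          U t \<omega> = X t \<omega> - (\<Sum>i=1..k. \<delta> i * (LBINT s:{0..t}. indicat_real {b i<..} (U s \<omega>)))"
        by blast
    qed
  qed
  then show ?thesis
    unfolding strong_solution_def using U_meas by blast
qed

theorem lemma2:
  fixes M :: "'a measure" and F :: "real \<Rightarrow> 'a measure" and X :: "real \<Rightarrow> 'a \<Rightarrow> real"
    and x \<gamma> \<sigma> :: real and \<nu> :: "real measure"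
    and k :: nat and \<delta> b :: "nat \<Rightarrow> real"
  assumes "spectrally_negative_levy_process M F X x \<gamma> \<sigma> \<nu>"
    and "1 \<le> k"
    and "\<forall>i\<in>{1..k}. 0 < \<delta> i"
    and "strict_mono_on {1..k} b"
    and "bounded_variation_paths M X \<Longrightarrow> (\<Sum>i=1..k. \<delta> i) < levy_drift \<gamma> \<nu>"
  shows "(\<exists>U. strong_solution M F X k \<delta> b U) \<and>
         (\<forall>U V. strong_solution M F X k \<delta> b U \<and> strong_solution M F X k \<delta> b V \<longrightarrow>
                indistinguishable M U V)"
proof -
  interpret spectrally_negative_levy_process M F X x \<gamma> \<sigma> \<nu>
    by fact
  have nonneg: "0 \<le> \<delta> i" if "i \<in> {1..k}" for i
    using assms(3) that by (simp add: less_imp_le)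
  have "0 < (\<Sum>i=1..k. \<delta> i)"
    using assms(2,3) by (intro sum_pos) auto
  then have "\<exists>U. strong_solution M F X k \<delta> b U"
    by (intro strong_solution_exists nonneg assms(5))
  moreover have "indistinguishable M U V"
    if "strong_solution M F X k \<delta> b U" "strong_solution M F X k \<delta> b V" for U V
    by (rule strong_solution_unique[OF _ that]) (rule nonneg)
  ultimately show ?thesis
    by blast
qed

end
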